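(* Let $n$ be a positive integer, $m$ an integer with $0 \le m \le n$, $\tau > 0$, $a_0, \dotsc, a_{n-1}, \alpha_0, \dotsc, \alpha_m \in \mathbb R$, and consider the delay-differential equation \[ y^{(n)}(t) + a_{n-1} y^{(n-1)}(t) + \dotsb + a_0 y(t) + \alpha_m y^{(m)}(t-\tau) + \dotsb + \alpha_0 y(t-\tau) = 0 , \] with real-valued unknown function $y$. Assume that there exists $s_0 \in \mathbb R$ such that \[ a_k = \binom{n}{k} (-s_0)^{n-k} + (-1)^{n-k}\, n! \sum_{j=k}^{n-1} \frac{\binom{j}{k}\binom{m+n-j}{m} s_0^{j-k}}{j!\,\tau^{n-j}} \quad \text{for every integer } k \text{ with } 0 \le k \le n-1, \] and \[ \alpha_k = (-1)^{n-1} e^{s_0 \tau} \sum_{j=k}^{m} \frac{(-1)^{j-k} (m+n-j)!\, s_0^{j-k}}{k!\,(j-k)!\,(m-j)!\,\tau^{n-j}} \quad \text{for every integer } k \text{ with } 0 \le k \le m . \] Then the trivial solution of the delay-differential equation is exponentially stable if and only if $a_{n-1} > -\frac{n(m+1)}{\tau}$.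
   Context: The convention $s_0^0 = 1$ is used, including when $s_0 = 0$. Solutions are understood in the standard sense for retarded ($m<n$) and neutral ($m=n$) functional differential equations: set $\alpha = \alpha_n$ if $m = n$ and $\alpha = 0$ if $m < n$; a solution is a function $y: [-\tau, \infty) \to \mathbb R$ of class $C^{n-1}$ such that $t \mapsto y^{(n-1)}(t) + \alpha\, y^{(n-1)}(t-\tau)$ is continuously differentiable on $[0, \infty)$ and the equation holds for all $t \ge 0$, where $y^{(n)}(t) + \alpha\, y^{(n)}(t-\tau)$ is interpreted as the derivative of that function. The trivial solution is exponentially stable if there exist $C > 0$ and $\omega > 0$ such that every solution $y$ satisfies $\max_{0 \le j \le n-1} |y^{(j)}(t)| \le C e^{-\omega t} \max_{0 \le j \le n-1} \max_{\theta \in [-\tau, 0]} |y^{(j)}(\theta)|$ for all $t \ge 0$. The spectral characterization recalled in the paper: with $\Delta(s) = s^n + \sum_{k=0}^{n-1} a_k s^k + e^{-s\tau} \sum_{k=0}^{m} \alpha_k s^k$ and $\gamma_0 = \sup\{\Re(s) : s \in \mathbb C,\ \Delta(s) = 0\}$, all solutions converge exponentially to $0$ if and only if $\gamma_0 < 0$ (J. K. Hale and S. M. Verduyn Lunel, Introduction to Functional Differential Equations). *)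

theory Defs
  imports "HOL-Analysis.Analysis"
begin

text \<open>
  Iterated derivatives relative to a set \<open>S\<close> (one-sided at the end points of an interval).
  For \<open>t \<in> S\<close> the value depends only on the restriction of \<open>f\<close> to \<open>S\<close>, so a function
  on \<open>S\<close> may be represented by any total function extending it.
\<close>

primrec deriv_on :: "real set \<Rightarrow> nat \<Rightarrow> (real \<Rightarrow> real) \<Rightarrow> real \<Rightarrow> real" where
  "deriv_on S 0 f = f"
| "deriv_on S (Suc j) f = (\<lambda>t. vector_derivative (deriv_on S j f) (at t within S))"

definition class_C_on :: "nat \<Rightarrow> real set \<Rightarrow> (real \<Rightarrow> real) \<Rightarrow> bool" where
  "class_C_on k S f \<longleftrightarrow>
     (\<forall>j<k. deriv_on S j f differentiable_on S) \<and> continuous_on S (deriv_on S k f)"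

definition neutral_coeff :: "nat \<Rightarrow> nat \<Rightarrow> (nat \<Rightarrow> real) \<Rightarrow> real" where
  "neutral_coeff n m \<alpha> = (if m = n then \<alpha> n else 0)"

text \<open>
  Only \<open>a k\<close> for \<open>k < n\<close> and \<open>\<alpha> k\<close> for \<open>k \<le> m\<close> matter, and \<open>n > 0\<close>, \<open>m \<le> n\<close> are intended.
  The terms of order \<open>n\<close>, delayed (if \<open>m = n\<close>) and undelayed, occur jointly as the derivative
  of \<open>y\<^sup>(\<^sup>n\<^sup>-\<^sup>1\<^sup>)(t) + \<alpha>\<^sub>n y\<^sup>(\<^sup>n\<^sup>-\<^sup>1\<^sup>)(t - \<tau>)\<close>, hence the sum over delayed terms omits \<open>k = n\<close>.
\<close>

definition dde_solution ::
  "nat \<Rightarrow> nat \<Rightarrow> real \<Rightarrow> (nat \<Rightarrow> real) \<Rightarrow> (nat \<Rightarrow> real) \<Rightarrow> (real \<Rightarrow> real) \<Rightarrow> bool" where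
  "dde_solution n m \<tau> a \<alpha> y \<longleftrightarrow>
     (let D = (\<lambda>k. deriv_on {-\<tau>..} k y);
          g = (\<lambda>t. D (n - 1) t + neutral_coeff n m \<alpha> * D (n - 1) (t - \<tau>))
      in class_C_on (n - 1) {-\<tau>..} y \<and>
         class_C_on 1 {0..} g \<and>
         (\<forall>t\<ge>0. deriv_on {0..} 1 g t + (\<Sum>k<n. a k * D k t)
                  + (\<Sum>k | k \<le> m \<and> k < n. \<alpha> k * D k (t - \<tau>)) = 0))"

definition dde_exp_stable ::
  "nat \<Rightarrow> nat \<Rightarrow> real \<Rightarrow> (nat \<Rightarrow> real) \<Rightarrow> (nat \<Rightarrow> real) \<Rightarrow> bool" where
  "dde_exp_stable n m \<tau> a \<alpha> \<longleftrightarrow>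
     (\<exists>C>0. \<exists>\<omega>>0. \<forall>y. dde_solution n m \<tau> a \<alpha> y \<longrightarrow>
        (\<forall>t\<ge>0. (MAX j\<in>{0..n - 1}. \<bar>deriv_on {-\<tau>..} j y t\<bar>)
           \<le> C * exp (- \<omega> * t) *
              (MAX j\<in>{0..n - 1}. SUP \<theta>\<in>{-\<tau>..0}. \<bar>deriv_on {-\<tau>..} j y \<theta>\<bar>)))"

end

theory Submission
  imports Defs
begin

text \<open>
  The case \<open>k = n - 1\<close> of the hypothesis on \<open>a\<close> reads \<open>a (n - 1) = - n s0 - n (m + 1) / \<tau>\<close>, so the
  condition on \<open>a (n - 1)\<close> says \<open>s0 < 0\<close>. If \<open>s0 \<ge> 0\<close>, the solution \<open>exp (s0 t)\<close> does not decay. The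
  content is that \<open>s0 < 0\<close> implies exponential stability. This is proved in the time domain, by a
  Lyapunov functional that takes the place of the location of the zeros of the characteristic
  function.

  Put \<open>z t = exp (- s0 t) * y t\<close>. The hypotheses say exactly that \<open>z\<close> solves the equation with the same
  \<open>n\<close>, \<open>m\<close>, \<open>\<tau>\<close> and with \<open>s0 = 0\<close>. Let \<open>K u = u^m * (\<tau> - u)^n\<close>. Integrating \<open>K u * exp (- s u)\<close> by parts
  over \<open>[0, \<tau>]\<close> until nothing is left gives
  \<open>fact m * \<tau>^n * (P s + exp (- s \<tau>) * Q s) / s^(n + m + 1)\<close>, where \<open>P + exp (- s \<tau>) Q\<close> is the
  characteristic function for \<open>s0 = 0\<close>; up to sign and a common factor, its coefficients are the
  values of the derivatives of \<open>K\<close> at \<open>0\<close> and \<open>\<tau>\<close>. The same integration by parts along a solution shows that, for the derivative \<open>w\<close>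
  of \<open>z\<close> of order \<open>n - 1\<close>, the integral of \<open>D^m K (u) * w (t - u)\<close> over \<open>[0, \<tau>]\<close> has a constant
  derivative in \<open>t\<close> (lemma \<open>pade_kernel_first_integral\<close>). Subtracting a multiple of \<open>t^(m + 1)\<close> from \<open>w\<close>
  makes that constant zero.

  By the formula of Rodrigues, \<open>D^m K = \<rho> J\<close> with the weight \<open>\<rho> u = (\<tau> - u)^(n - m)\<close> and a polynomial \<open>J\<close>
  of degree \<open>m\<close> that is \<open>\<rho>\<close>-orthogonal to all polynomials of smaller degree. Consider the squared
  \<open>\<rho>\<close>-weighted distance of the window \<open>u \<mapsto> w (t - u)\<close>, \<open>0 \<le> u \<le> \<tau>\<close>, from the polynomials of degree at most \<open>m\<close>.
  It is nonincreasing in \<open>t\<close> (lemma \<open>energy_bound\<close>). So \<open>w\<close> stays, on every window, within a fixed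
  distance from some polynomial of degree at most \<open>m\<close>. Iterated differences of order \<open>m + 1\<close> remove that
  polynomial, and summing them up again costs only polynomial growth: for every \<open>\<epsilon> > 0\<close>, \<open>w\<close> is
  bounded by a constant times \<open>exp (\<epsilon> t)\<close> times the size of the initial data (lemmas
  \<open>homogeneous_growth\<close> and \<open>inhomogeneous_growth\<close>). Integrating back to \<open>z\<close> and returning to \<open>y\<close>, every
  derivative of \<open>y\<close> up to order \<open>n - 1\<close> is \<open>O(exp ((s0 + \<epsilon>) t))\<close>, and \<open>\<epsilon> = - s0 / 2\<close> finishes the proof.
  The retarded and the neutral case need no distinction.
\<close>


section \<open>Orthonormal polynomials for an abstract inner product\<close>

text \<open>
  Gram--Schmidt, in the form of a reproducing identity: this is what turns coefficients with respect
  to \<open>p\<close> into an orthogonal projection.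
\<close>

lemma reproducing_family:
  fixes ip :: "real poly \<Rightarrow> real poly \<Rightarrow> real"
  assumes sym: "\<And>f g. ip f g = ip g f"
    and add: "\<And>f g k. ip (f + g) k = ip f k + ip g k"
    and scale: "\<And>c f g. ip (smult c f) g = c * ip f g"
    and pos: "\<And>f. f \<noteq> 0 \<Longrightarrow> ip f f > 0"
  shows "\<exists>p. (\<forall>i\<le>m. degree (p i) \<le> m) \<and>
    (\<forall>f. degree f \<le> m \<longrightarrow> f = (\<Sum>i\<le>m. smult (ip f (p i)) (p i)))"
proof (induction m)
  have zero: "ip 0 g = 0" for g
    using scale[of 0 0 g] by simp
  have add_r: "ip k (f + g) = ip k f + ip k g" for f g k
    using add sym by metis
  have scale_r: "ip g (smult c f) = c * ip g f" for c f g
    using scale sym by metis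
  have sum_l: "ip (\<Sum>i\<in>A. f i) g = (\<Sum>i\<in>A. ip (f i) g)" if "finite A" for A :: "nat set" and f g
    using that by (induction A rule: finite_induct) (auto simp: zero add)
  {
    case 0
    define c where "c = ip 1 1"
    have c: "c > 0" unfolding c_def by (rule pos) simp
    show ?case
    proof (intro exI conjI allI impI)
      fix f :: "real poly" assume "degree f \<le> 0"
      then obtain a where f: "f = smult a 1"
        by (metis degree_eq_zeroE le_zero_eq mult.right_neutral one_pCons smult_0_right smult_pCons)
      have "ip f (smult (1 / sqrt c) 1) = a * sqrt c"
        using c by (simp only: f scale scale_r flip: c_def) (simp add: real_div_sqrt flip: times_divide_eq_right)
      then show "f = (\<Sum>i\<le>0::nat. smult (ip f ((\<lambda>i. smult (1 / sqrt c) 1) i)) ((\<lambda>i. smult (1 / sqrt c) 1) i))"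
        using c by (simp only: f) simp
    qed auto
  next
    case (Suc m)
    then obtain p where deg: "\<And>i. i \<le> m \<Longrightarrow> degree (p i) \<le> m"
      and rep: "\<And>f. degree f \<le> m \<Longrightarrow> f = (\<Sum>i\<le>m. smult (ip f (p i)) (p i))"
      by blast
    define x :: "real poly" where "x = monom 1 (Suc m)"
    define s where "s = (\<Sum>i\<le>m. smult (ip x (p i)) (p i))"
    \<comment> \<open>the part of the new monomial that is orthogonal to degree at most \<open>m\<close>\<close>
    define f0 where "f0 = x + smult (-1) s"
    have degs: "degree s \<le> m" unfolding s_def
      by (rule degree_sum_le) (auto intro: order_trans[OF degree_smult_le] deg)
    have ips: "ip g s = ip g x" if "degree g \<le> m" for g
    proof -
      have "ip g s = ip s g" by (rule sym)
      also have "\<dots> = (\<Sum>i\<le>m. ip x (p i) * ip (p i) g)"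
        by (simp add: s_def sum_l scale)
      also have "\<dots> = ip (\<Sum>i\<le>m. smult (ip g (p i)) (p i)) x"
        by (simp add: sum_l scale sym[of x] sym[of g] mult.commute)
      also have "\<dots> = ip g x" using rep[OF that] by simp
      finally show ?thesis .
    qed
    have orth: "ip g f0 = 0" if "degree g \<le> m" for g
      using ips[OF that] by (simp only: f0_def add_r scale_r)
    have lead: "coeff f0 (Suc m) = 1"
      using degs by (simp add: f0_def x_def coeff_eq_0)
    have degf0: "degree f0 \<le> Suc m"
      unfolding f0_def x_def using degs
      by (intro degree_add_le) (auto simp: degree_monom_eq)
    have "f0 \<noteq> 0" using lead by auto
    define c where "c = ip f0 f0"
    have c: "c > 0" unfolding c_def by (rule pos) fact
    define p' where "p' = p(Suc m := smult (1 / sqrt c) f0)"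
    show ?case
    proof (intro exI[of _ p'] conjI allI impI)
      fix i assume "i \<le> Suc m"
      then show "degree (p' i) \<le> Suc m"
        using deg[of i] degf0 by (auto simp: p'_def le_Suc_eq intro: order_trans[OF degree_smult_le])
    next
      fix f :: "real poly" assume df: "degree f \<le> Suc m"
      define a where "a = coeff f (Suc m)"
      define g where "g = f + smult (-a) f0"
      have "degree g \<le> m"
      proof (rule degree_le, intro allI impI)
        fix i assume "m < i"
        then consider "i = Suc m" | "i > Suc m" by linarith
        then show "coeff g i = 0"
          by cases (use lead df degf0 in \<open>auto simp: g_def a_def coeff_eq_0\<close>)
      qed
      have f: "f = g + smult a f0" by (simp add: g_def)
      have 1: "ip f (p i) = ip g (p i)" if "i \<le> m" for i
        using orth[OF deg[OF that]] by (simp add: f add scale sym[of f0])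
      have 2: "ip f f0 = a * c"
        using orth[OF \<open>degree g \<le> m\<close>] by (simp add: f add scale c_def)
      have "(\<Sum>i\<le>Suc m. smult (ip f (p' i)) (p' i)) = (\<Sum>i\<le>m. smult (ip f (p i)) (p i)) + smult (ip f (smult (1 / sqrt c) f0)) (smult (1 / sqrt c) f0)"
        by (simp add: p'_def)
      also have "(\<Sum>i\<le>m. smult (ip f (p i)) (p i)) = g"
        using rep[OF \<open>degree g \<le> m\<close>] by (simp add: 1)
      also have "smult (ip f (smult (1 / sqrt c) f0)) (smult (1 / sqrt c) f0) = smult a f0"
        using c by (simp add: scale_r 2)
      finally show "f = (\<Sum>i\<le>Suc m. smult (ip f (p' i)) (p' i))" by (simp add: f)
    qed
  }
qed

section \<open>Integrals over a moving window\<close>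

lemma continuous_on_shift_reflect:
  fixes w :: "real \<Rightarrow> real"
  assumes "continuous_on UNIV w"
  shows "continuous_on S (\<lambda>u. w (t - u))"
  by (rule continuous_on_compose2[OF assms]) (auto intro!: continuous_intros)

definition pint :: "real \<Rightarrow> real poly \<Rightarrow> real" where
  "pint \<tau> f = integral {0..\<tau>} (\<lambda>u. poly f u)"

text \<open>
  The window is parametrised by the delay \<open>u\<close>; as functionals of the polynomial, \<open>pint\<close> and \<open>wint\<close> are
  linear, and all later computations with them are bookkeeping with this linearity.
\<close>

definition wint :: "real \<Rightarrow> (real \<Rightarrow> real) \<Rightarrow> real \<Rightarrow> real poly \<Rightarrow> real" where
  "wint \<tau> w t f = integral {0..\<tau>} (\<lambda>u. poly f u * w (t - u))"

lemma poly_integrable [simp]: "poly f integrable_on {0..\<tau>::real}"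
  by (intro integrable_continuous_real continuous_intros)

lemma wint_integrable [simp]:
  "continuous_on UNIV w \<Longrightarrow> (\<lambda>u. poly f u * w (t - u)) integrable_on {0..\<tau>::real}"
  by (intro integrable_continuous_real continuous_intros continuous_on_shift_reflect)

lemma pint_add: "pint \<tau> (f + g) = pint \<tau> f + pint \<tau> g"
  unfolding pint_def poly_add by (rule integral_add) auto

lemma pint_smult: "pint \<tau> (smult c f) = c * pint \<tau> f"
  unfolding pint_def poly_smult by (rule integral_mult_right)

lemma pint_0 [simp]: "pint \<tau> 0 = 0"
  unfolding pint_def poly_0 by simp

lemma pint_pderiv: "\<tau> \<ge> 0 \<Longrightarrow> pint \<tau> (pderiv f) = poly f \<tau> - poly f 0"
  unfolding pint_def
  by (intro integral_unique fundamental_theorem_of_calculus)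
     (auto simp flip: has_real_derivative_iff_has_vector_derivative
           intro: has_field_derivative_at_within poly_DERIV)

lemma wint_add: "continuous_on UNIV w \<Longrightarrow> wint \<tau> w t (f + g) = wint \<tau> w t f + wint \<tau> w t g"
  by (simp add: wint_def distrib_right integral_add)

lemma wint_smult: "wint \<tau> w t (smult c f) = c * wint \<tau> w t f"
  by (simp add: wint_def mult.assoc)

lemma wint_0 [simp]: "wint \<tau> w t 0 = 0"
  by (simp add: wint_def)

lemma wint_sum: "continuous_on UNIV w \<Longrightarrow> finite A \<Longrightarrow> wint \<tau> w t (\<Sum>i\<in>A. f i) = (\<Sum>i\<in>A. wint \<tau> w t (f i))"
  by (rotate_tac, induction A rule: finite_induct) (auto simp: wint_add)

text \<open>
  Induction on the polynomial avoids differentiation under the integral sign: the factor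
  \<open>u = t - (t - u)\<close> can be moved onto \<open>w\<close>, which therefore varies in the induction. For constant
  polynomials it is the fundamental theorem of calculus.
\<close>

lemma wint_has_derivative:
  assumes "continuous_on UNIV w" "\<tau> \<ge> 0"
  shows "((\<lambda>t. wint \<tau> w t f) has_real_derivative
    poly f 0 * w t - poly f \<tau> * w (t - \<tau>) + wint \<tau> w t (pderiv f)) (at t)"
  using assms(1)
proof (induction f arbitrary: w)
  case 0
  then show ?case by simp
next
  case (pCons c f)
  note w = \<open>continuous_on UNIV w\<close>
  have "\<exists>F. \<forall>x. -\<infinity> < ereal x \<longrightarrow> ereal x < \<infinity> \<longrightarrow> (F has_vector_derivative w x) (at x)"
    using w by (intro einterval_antiderivative) (auto simp: continuous_on_eq_continuous_at)
  then obtain F where F: "\<And>x. (F has_real_derivative w x) (at x)"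
    by (auto simp: has_real_derivative_iff_has_vector_derivative)
  note DF = DERIV_chain2[OF F]
  have const: "integral {0..\<tau>} (\<lambda>u. w (t - u)) = F t - F (t - \<tau>)" for t
  proof -
    have "((\<lambda>u. w (t - u)) has_integral (- F (t - \<tau>) - (- F (t - 0)))) {0..\<tau>}"
    proof (rule fundamental_theorem_of_calculus[OF \<open>\<tau> \<ge> 0\<close>])
      fix u
      have "((\<lambda>u. - F (t - u)) has_real_derivative w (t - u)) (at u)"
        by (rule derivative_eq_intros DF refl | simp)+
      then show "((\<lambda>u. - F (t - u)) has_vector_derivative w (t - u)) (at u within {0..\<tau>})"
        by (simp add: has_real_derivative_iff_has_vector_derivative has_vector_derivative_at_within)
    qed
    then show ?thesis by (simp add: integral_unique)
  qed
  define sw where "sw = (\<lambda>s. s * w s)"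
  have sw: "continuous_on UNIV sw" unfolding sw_def using w by (intro continuous_intros)
  have eq: "wint \<tau> w t (pCons c f) = c * (F t - F (t - \<tau>)) + (t * wint \<tau> w t f - wint \<tau> sw t f)" for t
  proof -
    have "wint \<tau> w t (pCons c f) = integral {0..\<tau>} (\<lambda>u. c * w (t - u) + (t * (poly f u * w (t - u)) - poly f u * sw (t - u)))"
      unfolding wint_def by (rule integral_cong) (simp add: sw_def algebra_simps)
    also have "\<dots> = integral {0..\<tau>} (\<lambda>u. c * w (t - u)) + integral {0..\<tau>} (\<lambda>u. t * (poly f u * w (t - u)) - poly f u * sw (t - u))"
      using w sw by (intro integral_add integrable_continuous_real continuous_intros continuous_on_shift_reflect)
    also have "integral {0..\<tau>} (\<lambda>u. t * (poly f u * w (t - u)) - poly f u * sw (t - u)) =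
        integral {0..\<tau>} (\<lambda>u. t * (poly f u * w (t - u))) - wint \<tau> sw t f"
      unfolding wint_def using w sw by (intro integral_diff integrable_continuous_real continuous_intros continuous_on_shift_reflect)
    also have "integral {0..\<tau>} (\<lambda>u. t * (poly f u * w (t - u))) = t * wint \<tau> w t f"
      by (simp add: wint_def)
    also have "integral {0..\<tau>} (\<lambda>u. c * w (t - u)) = c * integral {0..\<tau>} (\<lambda>u. w (t - u))"
      by simp
    finally show ?thesis by (simp add: const)
  qed
  have der: "((\<lambda>t. c * (F t - F (t - \<tau>)) + (t * wint \<tau> w t f - wint \<tau> sw t f)) has_real_derivative
     c * (w t - w (t - \<tau>)) + ((wint \<tau> w t f + t * (poly f 0 * w t - poly f \<tau> * w (t - \<tau>) + wint \<tau> w t (pderiv f)))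
       - (poly f 0 * sw t - poly f \<tau> * sw (t - \<tau>) + wint \<tau> sw t (pderiv f)))) (at t)"
    by (rule derivative_eq_intros pCons.IH[OF w] pCons.IH[OF sw] F DF refl | simp)+
  have eq2: "wint \<tau> w t (pCons 0 (pderiv f)) = t * wint \<tau> w t (pderiv f) - wint \<tau> sw t (pderiv f)"
  proof -
    have "wint \<tau> w t (pCons 0 (pderiv f)) = integral {0..\<tau>} (\<lambda>u. t * (poly (pderiv f) u * w (t - u)) - poly (pderiv f) u * sw (t - u))"
      unfolding wint_def by (rule integral_cong) (simp add: sw_def algebra_simps)
    also have "\<dots> = integral {0..\<tau>} (\<lambda>u. t * (poly (pderiv f) u * w (t - u))) - wint \<tau> sw t (pderiv f)"
      unfolding wint_def using w sw by (intro integral_diff integrable_continuous_real continuous_intros continuous_on_shift_reflect)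
    finally show ?thesis by (simp add: wint_def)
  qed
  have "pderiv (pCons c f) = f + pCons 0 (pderiv f)" by (simp add: pderiv_pCons)
  then show ?case
    unfolding eq
    using der by (simp add: wint_add[OF w] eq2 sw_def algebra_simps)
qed

section \<open>A Lyapunov functional\<close>

lemma wint_square_deviation:
  fixes w :: "real \<Rightarrow> real"
  assumes w: "continuous_on UNIV w"
  shows "integral {0..\<tau>} (\<lambda>u. poly f u * (w (t - u) - poly g u)\<^sup>2) =
    wint \<tau> (\<lambda>s. (w s)\<^sup>2) t f - 2 * wint \<tau> w t (f * g) + pint \<tau> (f * g * g)"
proof -
  have "integral {0..\<tau>} (\<lambda>u. poly f u * (w (t - u) - poly g u)\<^sup>2) =
    integral {0..\<tau>} (\<lambda>u. (poly f u * (w (t - u))\<^sup>2 - 2 * (poly (f * g) u * w (t - u))) + poly (f * g * g) u)"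
    by (rule integral_cong) (simp add: power2_eq_square algebra_simps)
  also have "\<dots> = integral {0..\<tau>} (\<lambda>u. poly f u * (w (t - u))\<^sup>2 - 2 * (poly (f * g) u * w (t - u))) + pint \<tau> (f * g * g)"
    unfolding pint_def using w
    by (intro integral_add integrable_continuous_real continuous_intros continuous_on_shift_reflect)
  also have "integral {0..\<tau>} (\<lambda>u. poly f u * (w (t - u))\<^sup>2 - 2 * (poly (f * g) u * w (t - u))) =
      wint \<tau> (\<lambda>s. (w s)\<^sup>2) t f - integral {0..\<tau>} (\<lambda>u. 2 * (poly (f * g) u * w (t - u)))"
    unfolding wint_def using w
    by (intro integral_diff integrable_continuous_real continuous_intros continuous_on_shift_reflect)
  finally show ?thesis by (simp add: wint_def)
qed

lemma pint_square_pos: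
  assumes \<tau>: "\<tau> > 0" and nonneg: "\<And>u. 0 \<le> u \<Longrightarrow> u \<le> \<tau> \<Longrightarrow> poly \<rho> u \<ge> 0"
    and "\<rho> \<noteq> 0" "f \<noteq> 0"
  shows "pint \<tau> (\<rho> * f * f) > 0"
proof -
  have nn: "poly (\<rho> * f * f) u \<ge> 0" if "u \<in> {0..\<tau>}" for u
    using nonneg[of u] that by (simp add: mult.assoc)
  have "pint \<tau> (\<rho> * f * f) \<ge> 0"
    unfolding pint_def by (rule integral_nonneg) (use nn in auto)
  moreover have "pint \<tau> (\<rho> * f * f) \<noteq> 0"
  proof
    assume "pint \<tau> (\<rho> * f * f) = 0"
    then have "\<forall>u\<in>{0..\<tau>}. poly (\<rho> * f * f) u = 0"
      unfolding pint_def using \<tau> nn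
      by (subst (asm) integral_eq_0_iff) (auto intro!: continuous_intros)
    then have "{0..\<tau>} \<subseteq> {u. poly (\<rho> * f * f) u = 0}" by blast
    moreover have "finite {u. poly (\<rho> * f * f) u = 0}"
      using assms by (intro poly_roots_finite) auto
    ultimately have "finite {0..\<tau>}" using finite_subset by blast
    with \<tau> show False using infinite_Icc by blast
  qed
  ultimately show ?thesis by linarith
qed

text \<open>
  The weight \<open>\<rho>\<close> does not increase along the window, so that old values of \<open>w\<close> never count more than
  recent ones, and \<open>J\<close> is a \<open>\<rho>\<close>-orthogonal polynomial of degree \<open>m\<close>. The equation attached to the pair states that the
  integral of \<open>\<rho> u * J u * w (t - u)\<close> over the window has derivative zero in \<open>t\<close>.
\<close>

locale delay_window =
  fixes \<tau> :: real and \<rho> J :: "real poly" and m :: nat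
  assumes \<tau>: "\<tau> > 0"
    and \<rho>_pos: "\<And>u. 0 \<le> u \<Longrightarrow> u < \<tau> \<Longrightarrow> poly \<rho> u > 0"
    and \<rho>_end: "poly \<rho> \<tau> \<ge> 0"
    and \<rho>_decr: "\<And>u. 0 \<le> u \<Longrightarrow> u \<le> \<tau> \<Longrightarrow> poly (pderiv \<rho>) u \<le> 0"
    and degJ: "degree J \<le> m" and J0: "poly J 0 \<noteq> 0"
    and orth: "\<And>f. degree f \<le> m \<Longrightarrow> coeff f m = 0 \<Longrightarrow> pint \<tau> (\<rho> * J * f) = 0"
begin

lemma \<rho>_nonneg: "0 \<le> u \<Longrightarrow> u \<le> \<tau> \<Longrightarrow> poly \<rho> u \<ge> 0"
  using \<rho>_pos[of u] \<rho>_end by (cases "u = \<tau>") auto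

lemma \<rho>_nz: "\<rho> \<noteq> 0"
  using \<rho>_pos[of 0] \<tau> by auto

lemma orth_pderiv: "degree f \<le> m \<Longrightarrow> pint \<tau> (\<rho> * J * pderiv f) = 0"
  by (rule orth) (auto simp: degree_pderiv coeff_pderiv coeff_eq_0)

text \<open>
  Let \<open>q\<close> be the \<open>\<rho>\<close>-orthogonal projection of the window onto the polynomials of degree at most \<open>m\<close>, and
  \<open>V t\<close> the squared distance of the window from \<open>q\<close>. Moving the window transports it by \<open>- d/du\<close>, which
  maps these polynomials to themselves; so \<open>V' t\<close> consists of boundary terms and of a term with
  \<open>\<rho>'\<close>. The equation allows the replacement of \<open>q\<close> by \<open>g = q + l J\<close> for an arbitrary number \<open>l\<close>. With the
  choice \<open>g 0 = w t\<close> the only positive boundary term vanishes, and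
  \<open>V' t = - \<rho> \<tau> * (w (t - \<tau>) - g \<tau>)\<^sup>2 + \<integral> \<rho>' u * (w (t - u) - g u)\<^sup>2 du \<le> 0\<close>.
\<close>

lemma energy_bound:
  fixes w :: "real \<Rightarrow> real"
  assumes w: "continuous_on UNIV w"
    and eq: "\<And>t. t \<ge> 0 \<Longrightarrow>
      poly (\<rho> * J) 0 * w t - poly (\<rho> * J) \<tau> * w (t - \<tau>) + wint \<tau> w t (pderiv (\<rho> * J)) = 0"
    and t: "t \<ge> 0"
  shows "\<exists>q. degree q \<le> m \<and>
    integral {0..\<tau>} (\<lambda>u. poly \<rho> u * (w (t - u) - poly q u)\<^sup>2)
      \<le> integral {0..\<tau>} (\<lambda>u. poly \<rho> u * (w (- u))\<^sup>2)"
proof -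
  define ip where "ip f g = pint \<tau> (\<rho> * f * g)" for f g
  have ip_sym: "ip f g = ip g f" for f g by (simp add: ip_def mult_ac)
  have ip_add: "ip (f + g) k = ip f k + ip g k" for f g k
    by (simp add: ip_def distrib_left distrib_right pint_add)
  have ip_scale: "ip (smult c f) k = c * ip f k" for c f k
    by (simp add: ip_def pint_smult)
  have ip_add_r: "ip k (f + g) = ip k f + ip k g" for f g k
    using ip_add ip_sym by metis
  have ip_scale_r: "ip k (smult c f) = c * ip k f" for c f k
    using ip_scale ip_sym by metis
  have ip_pos: "ip f f > 0" if "f \<noteq> 0" for f
    unfolding ip_def by (rule pint_square_pos) (use \<tau> \<rho>_nonneg \<rho>_nz that in auto)
  obtain p where degp: "\<And>i. i \<le> m \<Longrightarrow> degree (p i) \<le> m"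
    and rep: "\<And>f. degree f \<le> m \<Longrightarrow> f = (\<Sum>i\<le>m. smult (ip f (p i)) (p i))"
    using reproducing_family[of ip m, OF ip_sym ip_add ip_scale ip_pos] by blast
  define M where "M i t = wint \<tau> w t (\<rho> * p i)" for i t
  define q where "q t = (\<Sum>i\<le>m. smult (M i t) (p i))" for t
  have degq: "degree (q t) \<le> m" for t
    unfolding q_def by (rule degree_sum_le) (auto intro: order_trans[OF degree_smult_le] degp)
  have ip_zero: "ip f 0 = 0" for f by (simp add: ip_def)
  have ip_sum: "ip f (\<Sum>i\<in>A. h i) = (\<Sum>i\<in>A. ip f (h i))" if "finite A" for f h and A :: "nat set"
    using that by (induction A rule: finite_induct) (auto simp: ip_zero ip_add_r)
  have proj: "wint \<tau> w t (\<rho> * f) = ip f (q t)" if "degree f \<le> m" for f t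
  proof -
    have "wint \<tau> w t (\<rho> * f) = wint \<tau> w t (\<rho> * (\<Sum>i\<le>m. smult (ip f (p i)) (p i)))"
      using rep[OF that] by simp
    also have "\<dots> = (\<Sum>i\<le>m. ip f (p i) * M i t)"
      using w by (simp add: sum_distrib_left wint_sum wint_smult M_def)
    also have "\<dots> = ip f (q t)"
      by (simp add: q_def ip_sum ip_scale_r mult.commute)
    finally show ?thesis .
  qed
  define V where "V t = wint \<tau> (\<lambda>s. (w s)\<^sup>2) t \<rho> - (\<Sum>i\<le>m. (M i t)\<^sup>2)" for t
  have V_eq: "V t = integral {0..\<tau>} (\<lambda>u. poly \<rho> u * (w (t - u) - poly (q t) u)\<^sup>2)" for t
  proof -
    have "(\<Sum>i\<le>m. (M i t)\<^sup>2) = wint \<tau> w t (\<rho> * q t)"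
      using w by (simp add: q_def sum_distrib_left wint_sum wint_smult flip: M_def)
                 (simp add: power2_eq_square)
    then show ?thesis
      unfolding wint_square_deviation[OF w] V_def
      using proj[OF degq, of t t] by (simp add: ip_def)
  qed
  have w2: "continuous_on UNIV (\<lambda>s. (w s)\<^sup>2)" using w by (intro continuous_intros)
  have V_deriv: "\<exists>y. (V has_real_derivative y) (at t) \<and> y \<le> 0" if "t \<ge> 0" for t
  proof (intro exI conjI)
    define dM where "dM i = poly (\<rho> * p i) 0 * w t - poly (\<rho> * p i) \<tau> * w (t - \<tau>) + wint \<tau> w t (pderiv (\<rho> * p i))" for i
    define dV where "dV = poly \<rho> 0 * (w t)\<^sup>2 - poly \<rho> \<tau> * (w (t - \<tau>))\<^sup>2 + wint \<tau> (\<lambda>s. (w s)\<^sup>2) t (pderiv \<rho>)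
       - (\<Sum>i\<le>m. 2 * M i t * dM i)"
    have DM: "(M i has_real_derivative dM i) (at t)" for i
      unfolding M_def dM_def by (rule wint_has_derivative[OF w less_imp_le[OF \<tau>]])
    show "(V has_real_derivative dV) (at t)"
      unfolding V_def dV_def
      by (rule derivative_eq_intros wint_has_derivative[OF w2] DM refl less_imp_le[OF \<tau>] | simp add: mult_ac)+
    define L where "L f = poly f 0 * w t - poly f \<tau> * w (t - \<tau>) + wint \<tau> w t (pderiv f)" for f
    have L_add: "L (f + g) = L f + L g" for f g
      by (simp add: L_def pderiv_add wint_add[OF w] algebra_simps)
    have L_smult: "L (smult c f) = c * L f" for f c
      by (simp add: L_def pderiv_smult wint_smult algebra_simps)
    have L_0: "L 0 = 0" by (simp add: L_def)
    have L_sum: "L (\<Sum>i\<in>A. h i) = (\<Sum>i\<in>A. L (h i))" if "finite A" for h and A :: "nat set"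
      using that by (induction A rule: finite_induct) (auto simp: L_0 L_add)
    \<comment> \<open>\<open>l\<close> is chosen such that \<open>g 0 = w t\<close>, which cancels the boundary term at the recent end\<close>
    define l where "l = (w t - poly (q t) 0) / poly J 0"
    define g where "g = q t + smult l J"
    have g0: "poly g 0 = w t" using J0 by (simp add: g_def l_def)
    have degg: "degree g \<le> m"
      unfolding g_def by (intro degree_add_le degq order_trans[OF degree_smult_le] degJ)
    \<comment> \<open>the equation is \<open>L (\<rho> * J) = 0\<close>; it turns \<open>q\<close> into \<open>g\<close>\<close>
    have "(\<Sum>i\<le>m. M i t * dM i) = L (\<rho> * q t)"
      by (simp add: q_def sum_distrib_left L_sum L_smult) (simp add: L_def dM_def)
    also have "\<dots> = L (\<rho> * g)"
      using eq[OF \<open>t \<ge> 0\<close>] by (simp add: g_def distrib_left L_add L_smult) (simp add: L_def)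
    finally have sum_L: "(\<Sum>i\<le>m. M i t * dM i) = L (\<rho> * g)" .
    have sum2: "(\<Sum>i\<le>m. 2 * M i t * dM i) = 2 * L (\<rho> * g)"
      unfolding sum_L[symmetric] by (simp add: sum_distrib_left mult.assoc)
    have degg': "degree (pderiv g) \<le> m" using degg by (simp add: degree_pderiv)
    have "wint \<tau> w t (\<rho> * pderiv g) = ip (pderiv g) (q t)" by (rule proj[OF degg'])
    also have "\<dots> = ip (pderiv g) g"
      using orth_pderiv[OF degg] by (simp add: g_def ip_add_r ip_scale_r) (simp add: ip_def mult_ac)
    finally have 1: "wint \<tau> w t (\<rho> * pderiv g) = ip (pderiv g) g" .
    have "pderiv (\<rho> * g * g) = pderiv \<rho> * g * g + smult 2 (\<rho> * pderiv g * g)"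
      using smult_add_left[of 1 1 "\<rho> * pderiv g * g"] by (simp add: pderiv_mult algebra_simps)
    then have 2: "2 * ip (pderiv g) g = poly \<rho> \<tau> * (poly g \<tau>)\<^sup>2 - poly \<rho> 0 * (w t)\<^sup>2 - pint \<tau> (pderiv \<rho> * g * g)"
      using pint_pderiv[of \<tau> "\<rho> * g * g"] \<tau> g0
      by (simp add: pint_add pint_smult ip_def power2_eq_square)
    have "L (\<rho> * g) = poly \<rho> 0 * (w t)\<^sup>2 - poly \<rho> \<tau> * poly g \<tau> * w (t - \<tau>) + wint \<tau> w t (pderiv \<rho> * g) + ip (pderiv g) g"
      by (simp add: L_def pderiv_mult wint_add[OF w] 1 g0 power2_eq_square mult.commute[of g])
    then have "dV = - (poly \<rho> \<tau> * (w (t - \<tau>) - poly g \<tau>)\<^sup>2) +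
        (wint \<tau> (\<lambda>s. (w s)\<^sup>2) t (pderiv \<rho>) - 2 * wint \<tau> w t (pderiv \<rho> * g) + pint \<tau> (pderiv \<rho> * g * g))"
      using 2 unfolding dV_def sum2 by (simp add: power2_eq_square algebra_simps)
    also have "\<dots> = - (poly \<rho> \<tau> * (w (t - \<tau>) - poly g \<tau>)\<^sup>2) +
        integral {0..\<tau>} (\<lambda>u. poly (pderiv \<rho>) u * (w (t - u) - poly g u)\<^sup>2)"
      by (simp add: wint_square_deviation[OF w])
    also have "\<dots> \<le> 0"
    proof -
      have "integral {0..\<tau>} (\<lambda>u. poly (pderiv \<rho>) u * (w (t - u) - poly g u)\<^sup>2) \<le> integral {0..\<tau>} (\<lambda>u. 0)"
        using w \<rho>_decr
        by (intro integral_le integrable_continuous_real continuous_intros continuous_on_shift_reflect)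
           (auto simp: mult_nonpos_nonneg)
      moreover have "poly \<rho> \<tau> * (w (t - \<tau>) - poly g \<tau>)\<^sup>2 \<ge> 0"
        using \<rho>_nonneg[of \<tau>] \<tau> by simp
      ultimately show ?thesis by simp
    qed
    finally show "dV \<le> 0" .
  qed
  have "V t \<le> V 0"
    using t by (rule DERIV_nonpos_imp_nonincreasing) (use V_deriv in auto)
  also have "V 0 \<le> wint \<tau> (\<lambda>s. (w s)\<^sup>2) 0 \<rho>"
    unfolding V_def by (simp add: sum_nonneg)
  finally have "V t \<le> wint \<tau> (\<lambda>s. (w s)\<^sup>2) 0 \<rho>" .
  then show ?thesis
    using degq[of t] by (auto simp: V_eq wint_def)
qed

end

section \<open>Growth from bounds on iterated differences\<close>

definition bdiff :: "real \<Rightarrow> (real \<Rightarrow> real) \<Rightarrow> real \<Rightarrow> real" where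
  "bdiff h F s = F s - F (s - h)"

lemma continuous_on_bdiff: "continuous_on UNIV F \<Longrightarrow> continuous_on UNIV (bdiff h F)"
  unfolding bdiff_def
  by (intro continuous_intros) (auto intro!: continuous_on_compose2[of UNIV F] continuous_intros)

lemma continuous_on_bdiff_funpow: "continuous_on UNIV F \<Longrightarrow> continuous_on UNIV ((bdiff h ^^ k) F)"
  by (induction k) (auto intro: continuous_on_bdiff)

lemma bdiff_funpow_minus:
  "(bdiff h ^^ k) (\<lambda>s. F s - G s) = (\<lambda>s. (bdiff h ^^ k) F s - (bdiff h ^^ k) G s)"
  by (induction k) (auto simp: bdiff_def)

lemma bdiff_zero: "(bdiff h ^^ k) (\<lambda>s. 0) = (\<lambda>s. 0)"
  by (induction k) (auto simp: bdiff_def)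

text \<open>
  A difference lowers the degree, because the leading coefficients cancel.
\<close>

lemma bdiff_poly_eq_0:
  assumes "degree q < k"
  shows "(bdiff h ^^ k) (poly q) = (\<lambda>s. 0)"
  using assms
proof (induction k arbitrary: q)
  case 0
  then show ?case by simp
next
  case (Suc k)
  define d where "d = q - pcompose q [:-h, 1:]"
  have step: "bdiff h (poly q) = poly d"
    by (auto simp: bdiff_def d_def poly_pcompose)
  have "(bdiff h ^^ k) (poly d) = (\<lambda>s. 0)"
  proof (cases "degree q = 0")
    case True
    then obtain c where "q = [:c:]" by (metis degree_eq_zeroE)
    then have "poly d = (\<lambda>s. 0)" by (auto simp: d_def poly_pcompose)
    then show ?thesis by (simp add: bdiff_zero)
  next
    case False
    have dc: "degree (pcompose q [:-h, 1:]) = degree q" by (simp add: degree_pcompose)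
    have "coeff (pcompose q [:-h, 1:]) (degree q) = coeff q (degree q)"
      using lead_coeff_comp[of "[:-h, 1:]" q] by (simp add: dc)
    then have "coeff d (degree q) = 0" by (simp add: d_def)
    moreover have "degree d \<le> degree q" unfolding d_def by (rule degree_diff_le) (simp_all add: dc)
    ultimately have "degree d < degree q"
      using False by (metis eq_zero_or_degree_less degree_0 gr0I le_neq_implies_less leading_coeff_0_iff)
    with Suc.prems have "degree d < k" by simp
    then show ?thesis by (rule Suc.IH)
  qed
  then show ?case by (simp only: funpow_Suc_right o_apply step)
qed

lemma integral_shift_real:
  fixes f :: "real \<Rightarrow> real"
  assumes "continuous_on UNIV f"
  shows "integral {a..b} (\<lambda>s. f (s - h)) = integral {a - h..b - h} f"
  using integral_shift[of a "-h" b f] continuous_on_subset[OF assms]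
  by (simp add: o_def)

lemma integral_reflect_shift:
  fixes f :: "real \<Rightarrow> real"
  assumes "continuous_on UNIV f"
  shows "integral {0..a} (\<lambda>u. f (t - u)) = integral {t - a..t} f"
proof -
  have c: "continuous_on UNIV (\<lambda>x. f (- x))"
    using continuous_on_shift_reflect[OF assms, of UNIV 0] by simp
  have "integral {0..a} (\<lambda>u. f (t - u)) = integral {0..a} (\<lambda>u. f (- (u - t)))" by simp
  also have "\<dots> = integral {- t..- (t - a)} (\<lambda>x. f (- x))"
    using integral_shift_real[OF c, of 0 a t] by simp
  also have "\<dots> = integral {t - a..t} f"
    using Henstock_Kurzweil_Integration.integral_reflect_real[of t "t - a" f] by simp
  finally show ?thesis .
qed

lemma abs_integrable_UNIV:
  fixes F :: "real \<Rightarrow> real"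
  shows "continuous_on UNIV F \<Longrightarrow> (\<lambda>s. \<bar>F s\<bar>) integrable_on {a..b}"
  by (intro integrable_continuous_real continuous_intros) (auto intro: continuous_on_subset)

lemma integral_abs_le_shift:
  assumes F: "continuous_on UNIV F"
  shows "integral {a..b} (\<lambda>s. \<bar>F s\<bar>) \<le>
    integral {a - h..b - h} (\<lambda>s. \<bar>F s\<bar>) + integral {a..b} (\<lambda>s. \<bar>bdiff h F s\<bar>)"
    and integral_abs_bdiff: "integral {a..b} (\<lambda>s. \<bar>bdiff h F s\<bar>) \<le>
    integral {a - h..b - h} (\<lambda>s. \<bar>F s\<bar>) + integral {a..b} (\<lambda>s. \<bar>F s\<bar>)"
proof -
  have aF: "continuous_on UNIV (\<lambda>s. \<bar>F s\<bar>)" using F by (intro continuous_intros)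
  have Fh: "continuous_on UNIV (\<lambda>s. F (s - h))"
    using F by (auto intro!: continuous_on_compose2[of UNIV F] continuous_intros)
  note ints = abs_integrable_UNIV[OF F] abs_integrable_UNIV[OF Fh] abs_integrable_UNIV[OF continuous_on_bdiff[OF F]]
  have eq: "integral {a..b} (\<lambda>s. \<bar>F (s - h)\<bar>) = integral {a - h..b - h} (\<lambda>s. \<bar>F s\<bar>)"
    by (rule integral_shift_real[OF aF])
  have "integral {a..b} (\<lambda>s. \<bar>F s\<bar>) \<le> integral {a..b} (\<lambda>s. \<bar>F (s - h)\<bar> + \<bar>bdiff h F s\<bar>)"
    by (intro integral_le integrable_add ints) (auto simp: bdiff_def)
  also have "\<dots> = integral {a..b} (\<lambda>s. \<bar>F (s - h)\<bar>) + integral {a..b} (\<lambda>s. \<bar>bdiff h F s\<bar>)"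
    by (intro integral_add ints)
  finally show "integral {a..b} (\<lambda>s. \<bar>F s\<bar>) \<le>
    integral {a - h..b - h} (\<lambda>s. \<bar>F s\<bar>) + integral {a..b} (\<lambda>s. \<bar>bdiff h F s\<bar>)" by (simp add: eq)
  have "integral {a..b} (\<lambda>s. \<bar>bdiff h F s\<bar>) \<le> integral {a..b} (\<lambda>s. \<bar>F (s - h)\<bar> + \<bar>F s\<bar>)"
    by (intro integral_le integrable_add ints) (auto simp: bdiff_def)
  also have "\<dots> = integral {a..b} (\<lambda>s. \<bar>F (s - h)\<bar>) + integral {a..b} (\<lambda>s. \<bar>F s\<bar>)"
    by (intro integral_add ints)
  finally show "integral {a..b} (\<lambda>s. \<bar>bdiff h F s\<bar>) \<le>
    integral {a - h..b - h} (\<lambda>s. \<bar>F s\<bar>) + integral {a..b} (\<lambda>s. \<bar>F s\<bar>)" by (simp add: eq)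
qed

lemma integral_abs_bdiff_funpow:
  assumes F: "continuous_on UNIV F" and h: "h \<ge> 0"
  shows "integral {a..b} (\<lambda>s. \<bar>(bdiff h ^^ k) F s\<bar>) \<le> 2 ^ k * integral {a - real k * h..b} (\<lambda>s. \<bar>F s\<bar>)"
proof (induction k arbitrary: a)
  case 0
  then show ?case by simp
next
  case (Suc k)
  let ?G = "(bdiff h ^^ k) F"
  have G: "continuous_on UNIV ?G" by (rule continuous_on_bdiff_funpow[OF F])
  have "integral {a..b} (\<lambda>s. \<bar>(bdiff h ^^ Suc k) F s\<bar>) \<le>
      integral {a - h..b - h} (\<lambda>s. \<bar>?G s\<bar>) + integral {a..b} (\<lambda>s. \<bar>?G s\<bar>)"
    using integral_abs_bdiff[OF G] by simp
  also have "integral {a - h..b - h} (\<lambda>s. \<bar>?G s\<bar>) \<le> integral {a - h..b} (\<lambda>s. \<bar>?G s\<bar>)"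
    using h by (intro integral_subset_le abs_integrable_UNIV[OF G]) auto
  also have "integral {a..b} (\<lambda>s. \<bar>?G s\<bar>) \<le> integral {a - h..b} (\<lambda>s. \<bar>?G s\<bar>)"
    using h by (intro integral_subset_le abs_integrable_UNIV[OF G]) auto
  also have "integral {a - h..b} (\<lambda>s. \<bar>?G s\<bar>) \<le> 2 ^ k * integral {a - h - real k * h..b} (\<lambda>s. \<bar>F s\<bar>)"
    by (rule Suc.IH)
  finally show ?case by (simp add: algebra_simps)
qed

text \<open>
  A function that gains at most \<open>M * exp (\<epsilon> t)\<close> over each step of length \<open>h\<close> accumulates a geometric
  series with ratio \<open>exp (- \<epsilon> h)\<close>, whence the denominator. The factor \<open>exp (\<epsilon> \<tau>)\<close> lets the bound also
  cover the initial interval \<open>[- \<tau>, 0]\<close>.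
\<close>

lemma exponential_recursion:
  fixes f :: "real \<Rightarrow> real"
  assumes "\<epsilon> > 0" "h > 0" "h \<le> \<tau>" "M \<ge> 0" "M' \<ge> 0"
    and init: "\<And>t. t \<le> 0 \<Longrightarrow> f t \<le> M'"
    and step: "\<And>t. t \<ge> 0 \<Longrightarrow> f t \<le> f (t - h) + M * exp (\<epsilon> * t)"
    and t: "t \<ge> - \<tau>"
  shows "f t \<le> (M' * exp (\<epsilon> * \<tau>) + M / (1 - exp (- \<epsilon> * h))) * exp (\<epsilon> * t)"
proof -
  define X where "X = M' * exp (\<epsilon> * \<tau>) + M / (1 - exp (- \<epsilon> * h))"
  have pos: "1 - exp (- \<epsilon> * h) > 0" using assms by simp
  have X1: "X \<ge> M' * exp (\<epsilon> * \<tau>)" unfolding X_def using pos \<open>M \<ge> 0\<close> by simp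
  have "X \<ge> M / (1 - exp (- \<epsilon> * h))" unfolding X_def using \<open>M' \<ge> 0\<close> by simp
  then have X2: "M \<le> X * (1 - exp (- \<epsilon> * h))" using pos by (simp add: field_simps)
  have base: "f t \<le> X * exp (\<epsilon> * t)" if "- \<tau> \<le> t" "t \<le> 0" for t
  proof -
    have "f t \<le> M' * 1" using init that by simp
    also have "\<dots> \<le> M' * exp (\<epsilon> * (\<tau> + t))"
      using assms that by (intro mult_left_mono) auto
    also have "\<dots> = M' * exp (\<epsilon> * \<tau>) * exp (\<epsilon> * t)"
      by (simp add: exp_add distrib_left)
    also have "\<dots> \<le> X * exp (\<epsilon> * t)" by (intro mult_right_mono X1) auto
    finally show ?thesis .
  qed
  have "\<forall>t. - \<tau> \<le> t \<and> t \<le> real k * h \<longrightarrow> f t \<le> X * exp (\<epsilon> * t)" for k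
  proof (induction k)
    case 0
    then show ?case using base by auto
  next
    case (Suc k)
    show ?case
    proof (intro allI impI)
      fix t assume t: "- \<tau> \<le> t \<and> t \<le> real (Suc k) * h"
      show "f t \<le> X * exp (\<epsilon> * t)"
      proof (cases "t \<le> 0")
        case True
        then show ?thesis using base t by simp
      next
        case False
        have "f t \<le> f (t - h) + M * exp (\<epsilon> * t)" using step False by simp
        also have "f (t - h) \<le> X * exp (\<epsilon> * (t - h))"
          using Suc.IH[rule_format, of "t - h"] t False \<open>h \<le> \<tau>\<close> by (simp add: algebra_simps)
        also have "X * exp (\<epsilon> * (t - h)) = X * exp (- \<epsilon> * h) * exp (\<epsilon> * t)"
          by (simp add: algebra_simps flip: exp_add)
        also have "M * exp (\<epsilon> * t) \<le> X * (1 - exp (- \<epsilon> * h)) * exp (\<epsilon> * t)"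
          by (intro mult_right_mono X2) auto
        finally show ?thesis by (simp add: algebra_simps)
      qed
    qed
  qed
  moreover obtain k where "t / h \<le> real k" using real_arch_simple by blast
  ultimately show ?thesis
    using t \<open>h > 0\<close> unfolding X_def[symmetric] by (auto simp: pos_divide_le_eq)
qed

text \<open>
  Undoing the differences one at a time. Integrals over windows are used instead of pointwise
  values, since this is the information that the Lyapunov functional provides. The constant is
  chosen before \<open>F\<close> and \<open>B\<close>: uniformity over all solutions is what exponential stability asks for.
\<close>

lemma bdiff_growth:
  assumes "\<epsilon> > 0" "h > 0" "h \<le> \<tau>" "M \<ge> 0"
  shows "\<exists>M'\<ge>0. \<forall>F B. continuous_on UNIV F \<longrightarrow> B \<ge> 0 \<longrightarrow> (\<forall>s\<le>0. \<bar>F s\<bar> \<le> B) \<longrightarrow>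
      (\<forall>t\<ge>0. integral {t - h..t} (\<lambda>s. \<bar>(bdiff h ^^ k) F s\<bar>) \<le> M * B * exp (\<epsilon> * t)) \<longrightarrow>
      (\<forall>t\<ge>-\<tau>. integral {t - h..t} (\<lambda>s. \<bar>F s\<bar>) \<le> M' * B * exp (\<epsilon> * t))"
proof (induction k)
  have init: "integral {t - h..t} (\<lambda>s. \<bar>F s\<bar>) \<le> h * B"
    if "continuous_on UNIV F" "\<forall>s\<le>0. \<bar>F s\<bar> \<le> B" "t \<le> 0" for F B t
  proof -
    have "integral {t - h..t} (\<lambda>s. \<bar>F s\<bar>) \<le> integral {t - h..t} (\<lambda>s. B)"
      using that \<open>h > 0\<close> by (intro integral_le abs_integrable_UNIV) auto
    then show ?thesis using \<open>h > 0\<close> by simp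
  qed
  {
    case 0
    define M' where "M' = max M (h * exp (\<epsilon> * \<tau>))"
    show ?case
    proof (intro exI[of _ M'] conjI allI impI)
      show "M' \<ge> 0" using \<open>M \<ge> 0\<close> by (simp add: M'_def)
      fix F B t
      assume F: "continuous_on UNIV F" and B: "B \<ge> 0" and FB: "\<forall>s\<le>0. \<bar>F s\<bar> \<le> B"
        and bd: "\<forall>t\<ge>0. integral {t - h..t} (\<lambda>s. \<bar>(bdiff h ^^ 0) F s\<bar>) \<le> M * B * exp (\<epsilon> * t)"
        and t: "- \<tau> \<le> t"
      show "integral {t - h..t} (\<lambda>s. \<bar>F s\<bar>) \<le> M' * B * exp (\<epsilon> * t)"
      proof (cases "t \<ge> 0")
        case True
        then have "integral {t - h..t} (\<lambda>s. \<bar>F s\<bar>) \<le> M * B * exp (\<epsilon> * t)" using bd by simp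
        also have "\<dots> \<le> M' * B * exp (\<epsilon> * t)" using B by (intro mult_right_mono) (auto simp: M'_def)
        finally show ?thesis .
      next
        case False
        then have "integral {t - h..t} (\<lambda>s. \<bar>F s\<bar>) \<le> h * B * 1" using init[OF F FB] by simp
        also have "\<dots> \<le> h * B * exp (\<epsilon> * (\<tau> + t))" using B t assms by (intro mult_left_mono) auto
        also have "\<dots> = h * exp (\<epsilon> * \<tau>) * B * exp (\<epsilon> * t)" by (simp add: exp_add distrib_left)
        also have "\<dots> \<le> M' * B * exp (\<epsilon> * t)" using B by (intro mult_right_mono) (auto simp: M'_def)
        finally show ?thesis .
      qed
    qed
  next
    case (Suc k)
    then obtain K where "K \<ge> 0" and K: "\<And>F B t. continuous_on UNIV F \<Longrightarrow> B \<ge> 0 \<Longrightarrow> (\<forall>s\<le>0. \<bar>F s\<bar> \<le> B) \<Longrightarrow>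
      (\<forall>t\<ge>0. integral {t - h..t} (\<lambda>s. \<bar>(bdiff h ^^ k) F s\<bar>) \<le> M * B * exp (\<epsilon> * t)) \<Longrightarrow>
      t \<ge> -\<tau> \<Longrightarrow> integral {t - h..t} (\<lambda>s. \<bar>F s\<bar>) \<le> K * B * exp (\<epsilon> * t)" by blast
    define M' where "M' = h * exp (\<epsilon> * \<tau>) + 2 * K / (1 - exp (- \<epsilon> * h))"
    have pos: "1 - exp (- \<epsilon> * h) > 0" using assms by simp
    show ?case
    proof (intro exI[of _ M'] conjI allI impI)
      show "M' \<ge> 0" using \<open>K \<ge> 0\<close> \<open>h > 0\<close> pos by (simp add: M'_def)
      fix F B t
      assume F: "continuous_on UNIV F" and B: "B \<ge> 0" and FB: "\<forall>s\<le>0. \<bar>F s\<bar> \<le> B"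
        and bd: "\<forall>t\<ge>0. integral {t - h..t} (\<lambda>s. \<bar>(bdiff h ^^ Suc k) F s\<bar>) \<le> M * B * exp (\<epsilon> * t)"
        and t: "- \<tau> \<le> t"
      have 1: "\<bar>bdiff h F s\<bar> \<le> 2 * B" if "s \<le> 0" for s
      proof -
        have "\<bar>F s\<bar> \<le> B" "\<bar>F (s - h)\<bar> \<le> B" using FB that \<open>h > 0\<close> by auto
        then show ?thesis by (simp add: bdiff_def)
      qed
      have 2: "integral {t - h..t} (\<lambda>s. \<bar>(bdiff h ^^ k) (bdiff h F) s\<bar>) \<le> M * (2 * B) * exp (\<epsilon> * t)" if "t \<ge> 0" for t
      proof -
        have "integral {t - h..t} (\<lambda>s. \<bar>(bdiff h ^^ k) (bdiff h F) s\<bar>) \<le> M * B * exp (\<epsilon> * t)"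
          using bd that by (simp add: funpow_swap1)
        also have "\<dots> \<le> M * (2 * B) * exp (\<epsilon> * t)"
          using \<open>M \<ge> 0\<close> B by (intro mult_right_mono mult_left_mono) auto
        finally show ?thesis .
      qed
      have 3: "integral {t - h..t} (\<lambda>s. \<bar>bdiff h F s\<bar>) \<le> K * (2 * B) * exp (\<epsilon> * t)" if "t \<ge> 0" for t
        using K[OF continuous_on_bdiff[OF F, of h], of "2 * B" t] 1 2 B that assms by auto
      have "integral {t - h..t} (\<lambda>s. \<bar>F s\<bar>) \<le> (h * B * exp (\<epsilon> * \<tau>) + K * (2 * B) / (1 - exp (- \<epsilon> * h))) * exp (\<epsilon> * t)"
      proof (rule exponential_recursion[where f = "\<lambda>t. integral {t - h..t} (\<lambda>s. \<bar>F s\<bar>)" and M' = "h * B" and M = "K * (2 * B)" and \<tau> = \<tau>])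
        fix t :: real assume "t \<ge> 0"
        have "integral {t - h..t} (\<lambda>s. \<bar>F s\<bar>) \<le> integral {t - h - h..t - h} (\<lambda>s. \<bar>F s\<bar>) + integral {t - h..t} (\<lambda>s. \<bar>bdiff h F s\<bar>)"
          by (rule integral_abs_le_shift[OF F])
        with 3[OF \<open>t \<ge> 0\<close>] show "integral {t - h..t} (\<lambda>s. \<bar>F s\<bar>) \<le> integral {t - h - h..t - h} (\<lambda>s. \<bar>F s\<bar>) + K * (2 * B) * exp (\<epsilon> * t)"
          by linarith
      qed (use init[OF F FB] assms B \<open>K \<ge> 0\<close> t in auto)
      also have "\<dots> = M' * B * exp (\<epsilon> * t)" by (simp add: M'_def algebra_simps)
      finally show "integral {t - h..t} (\<lambda>s. \<bar>F s\<bar>) \<le> M' * B * exp (\<epsilon> * t)" .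
    qed
  }
qed

section \<open>Growth of solutions of the window equation\<close>

context delay_window
begin

text \<open>
  On the recent half of the window, \<open>\<rho>\<close> is bounded below, so \<open>energy_bound\<close> controls the integral of
  \<open>\<bar>w - Q\<bar>\<close> there for a polynomial \<open>Q\<close> of degree at most \<open>m\<close> that depends on \<open>t\<close>. Differences of order
  \<open>m + 1\<close> do not see \<open>Q\<close>. Once the integrals of \<open>\<bar>w\<bar>\<close> are bounded, the equation itself gives a pointwise
  bound, because \<open>\<bar>\<rho> \<tau> * J \<tau>\<bar> \<le> \<bar>\<rho> 0 * J 0\<bar>\<close>: the step from \<open>t - \<tau>\<close> to \<open>t\<close> amplifies nothing.
\<close>

lemma homogeneous_growth:
  assumes \<epsilon>: "\<epsilon> > 0"
  shows "\<exists>C>0. \<forall>w B. continuous_on UNIV w \<longrightarrow> B > 0 \<longrightarrow> (\<forall>s\<le>0. \<bar>w s\<bar> \<le> B) \<longrightarrow>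
    (\<forall>t\<ge>0. poly (\<rho> * J) 0 * w t - poly (\<rho> * J) \<tau> * w (t - \<tau>) + wint \<tau> w t (pderiv (\<rho> * J)) = 0) \<longrightarrow>
    (\<forall>t\<ge>-\<tau>. \<bar>w t\<bar> \<le> C * B * exp (\<epsilon> * t))"
proof -
  \<comment> \<open>an integral over a length \<open>h\<close> and \<open>m + 1\<close> differences of step \<open>h\<close> reach back by \<open>(m + 2) h = \<tau> / 2\<close>\<close>
  define h where "h = \<tau> / (2 * (real m + 2))"
  have h: "h > 0" "h \<le> \<tau>" using \<tau> by (auto simp: h_def field_simps)
  have hm: "(real m + 2) * h = \<tau> / 2" by (simp add: h_def divide_simps)
  define c where "c = poly \<rho> (\<tau> / 2)"
  have c: "c > 0" unfolding c_def using \<rho>_pos \<tau> by simp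
  have \<rho>_ge: "poly \<rho> u \<ge> c" if "0 \<le> u" "u \<le> \<tau> / 2" for u
    unfolding c_def using that(2)
  proof (rule DERIV_nonpos_imp_nonincreasing)
    fix x assume "u \<le> x" "x \<le> \<tau> / 2"
    then show "\<exists>y. (poly \<rho> has_real_derivative y) (at x) \<and> y \<le> 0"
      using \<rho>_decr[of x] that \<tau> by (intro exI[of _ "poly (pderiv \<rho>) x"]) (auto intro: poly_DERIV)
  qed
  define R where "R = pint \<tau> \<rho>"
  have R: "R \<ge> 0" unfolding R_def pint_def by (rule integral_nonneg) (use \<rho>_nonneg in auto)
  define M where "M = 2 ^ (m + 1) * (\<tau> / 4 + R / (2 * c))"
  have M: "M \<ge> 0" unfolding M_def using \<tau> R c by simp
  obtain X where "X \<ge> 0" and X: "\<And>F B t. continuous_on UNIV F \<Longrightarrow> B \<ge> 0 \<Longrightarrow> (\<forall>s\<le>0. \<bar>F s\<bar> \<le> B) \<Longrightarrow>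
      (\<forall>t\<ge>0. integral {t - h..t} (\<lambda>s. \<bar>(bdiff h ^^ (m + 1)) F s\<bar>) \<le> M * B * exp (\<epsilon> * t)) \<Longrightarrow>
      t \<ge> -\<tau> \<Longrightarrow> integral {t - h..t} (\<lambda>s. \<bar>F s\<bar>) \<le> X * B * exp (\<epsilon> * t)"
    using bdiff_growth[OF \<epsilon> h M, of "m + 1"] by blast
  define N where "N = 2 * (m + 2)"
  have Nh: "real N * h = \<tau>" using hm by (simp add: N_def algebra_simps)
  obtain H where H: "\<And>u. u \<in> {0..\<tau>} \<Longrightarrow> \<bar>poly (pderiv (\<rho> * J)) u\<bar> \<le> H"
  proof -
    have "compact ((\<lambda>u. poly (pderiv (\<rho> * J)) u) ` {0..\<tau>})"
      by (intro compact_continuous_image continuous_intros compact_Icc)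
    then have "bounded ((\<lambda>u. poly (pderiv (\<rho> * J)) u) ` {0..\<tau>})" by (rule compact_imp_bounded)
    then obtain H where "\<forall>x\<in>(\<lambda>u. poly (pderiv (\<rho> * J)) u) ` {0..\<tau>}. norm x \<le> H"
      unfolding bounded_iff by blast
    then show ?thesis using that[of H] by (simp del: poly_mult)
  qed
  have "H \<ge> 0" using H[of 0] \<tau> by (auto intro: order_trans[OF abs_ge_zero])
  define b0 where "b0 = poly (\<rho> * J) 0"
  have b0: "b0 \<noteq> 0" using \<rho>_pos[of 0] \<tau> J0 by (auto simp: b0_def)
  have b1: "\<bar>poly (\<rho> * J) \<tau>\<bar> \<le> \<bar>b0\<bar>"
  proof -
    have dint: "pderiv (\<rho> * J * J) = pderiv \<rho> * J * J + smult 2 (\<rho> * J * pderiv J)"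
      using smult_add_left[of 1 1 "\<rho> * J * pderiv J"] by (simp add: pderiv_mult algebra_simps)
    have "pint \<tau> (pderiv \<rho> * J * J) = poly \<rho> \<tau> * (poly J \<tau>)\<^sup>2 - poly \<rho> 0 * (poly J 0)\<^sup>2"
      using pint_pderiv[of \<tau> "\<rho> * J * J"] orth_pderiv[OF degJ] \<tau>
      unfolding dint by (simp add: pint_add pint_smult power2_eq_square)
    moreover have "pint \<tau> (pderiv \<rho> * J * J) \<le> integral {0..\<tau>} (\<lambda>u. 0)"
      unfolding pint_def
      using \<rho>_decr by (intro integral_le) (auto simp: mult.assoc mult_nonpos_nonneg)
    ultimately have 1: "poly \<rho> \<tau> * (poly J \<tau>)\<^sup>2 \<le> poly \<rho> 0 * (poly J 0)\<^sup>2" by simp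
    have 2: "poly \<rho> \<tau> \<le> poly \<rho> 0"
    proof (rule DERIV_nonpos_imp_nonincreasing[OF less_imp_le[OF \<tau>]])
      fix x assume "0 \<le> x" "x \<le> \<tau>"
      then show "\<exists>y. (poly \<rho> has_real_derivative y) (at x) \<and> y \<le> 0"
        using \<rho>_decr[of x] by (intro exI[of _ "poly (pderiv \<rho>) x"]) (auto intro: poly_DERIV)
    qed
    have "poly \<rho> \<tau> * (poly \<rho> \<tau> * (poly J \<tau>)\<^sup>2) \<le> poly \<rho> 0 * (poly \<rho> 0 * (poly J 0)\<^sup>2)"
      using 1 2 \<rho>_end by (rule_tac mult_mono) auto
    then have "(poly (\<rho> * J) \<tau>)\<^sup>2 \<le> b0\<^sup>2"
      by (simp add: b0_def power2_eq_square algebra_simps)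
    then show ?thesis by (simp add: abs_le_square_iff)
  qed
  define K where "K = H * (real N * X) / \<bar>b0\<bar>"
  have K: "K \<ge> 0" using \<open>H \<ge> 0\<close> \<open>X \<ge> 0\<close> by (simp add: K_def)
  define C where "C = 1 * exp (\<epsilon> * \<tau>) + K / (1 - exp (- \<epsilon> * \<tau>))"
  have "C > 0" unfolding C_def using \<epsilon> \<tau> K by (intro add_pos_nonneg) auto
  show ?thesis
  proof (intro exI[of _ C] conjI allI impI)
    show "C > 0" by fact
    fix w :: "real \<Rightarrow> real" and B t :: real
    assume w: "continuous_on UNIV w" and B: "B > 0" and wB: "\<forall>s\<le>0. \<bar>w s\<bar> \<le> B"
      and eq: "\<forall>t\<ge>0. poly (\<rho> * J) 0 * w t - poly (\<rho> * J) \<tau> * w (t - \<tau>) + wint \<tau> w t (pderiv (\<rho> * J)) = 0"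
      and t: "- \<tau> \<le> t"
    have diff: "integral {t - h..t} (\<lambda>s. \<bar>(bdiff h ^^ (m + 1)) w s\<bar>) \<le> M * B * exp (\<epsilon> * t)" if "t \<ge> 0" for t
    proof -
      obtain q where degq: "degree q \<le> m" and q:
        "integral {0..\<tau>} (\<lambda>u. poly \<rho> u * (w (t - u) - poly q u)\<^sup>2)
          \<le> integral {0..\<tau>} (\<lambda>u. poly \<rho> u * (w (- u))\<^sup>2)"
        using energy_bound[OF w, of t] eq \<open>t \<ge> 0\<close> by blast
      have "integral {0..\<tau>} (\<lambda>u. poly \<rho> u * (w (- u))\<^sup>2) \<le> integral {0..\<tau>} (\<lambda>u. poly \<rho> u * B\<^sup>2)"
        using w wB B \<rho>_nonneg continuous_on_shift_reflect[OF w, of "{0..\<tau>}" 0]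
        by (intro integral_le integrable_continuous_real continuous_intros mult_left_mono)
           (auto simp flip: abs_le_square_iff)
      also have "\<dots> = R * B\<^sup>2" by (simp add: R_def pint_def)
      finally have E: "integral {0..\<tau>} (\<lambda>u. poly \<rho> u * (w (t - u) - poly q u)\<^sup>2) \<le> R * B\<^sup>2"
        using q by linarith
      define Q where "Q = pcompose q [:t, -1:]"
      have Qs: "poly Q s = poly q (t - s)" for s by (simp add: Q_def poly_pcompose)
      have "degree Q < m + 1" using degq by (simp add: Q_def degree_pcompose)
      define r where "r s = w s - poly Q s" for s
      have r: "continuous_on UNIV r" unfolding r_def by (intro continuous_intros w)
      have "(bdiff h ^^ (m + 1)) w = (bdiff h ^^ (m + 1)) r"
        unfolding r_def bdiff_funpow_minus bdiff_poly_eq_0[OF \<open>degree Q < m + 1\<close>] by simp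
      then have "integral {t - h..t} (\<lambda>s. \<bar>(bdiff h ^^ (m + 1)) w s\<bar>) \<le>
          2 ^ (m + 1) * integral {t - h - real (m + 1) * h..t} (\<lambda>s. \<bar>r s\<bar>)"
        using integral_abs_bdiff_funpow[OF r, of h "t - h" t "m + 1"] h by simp
      also have "t - h - real (m + 1) * h = t - \<tau> / 2" using hm by (simp add: algebra_simps)
      also have "integral {t - \<tau> / 2..t} (\<lambda>s. \<bar>r s\<bar>) = integral {0..\<tau> / 2} (\<lambda>u. \<bar>r (t - u)\<bar>)"
        by (rule integral_reflect_shift[symmetric]) (intro continuous_intros r)
      also have "\<dots> \<le> integral {0..\<tau> / 2} (\<lambda>u. B / 2 + 1 / (2 * c * B) * (poly \<rho> u * (r (t - u))\<^sup>2))"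
      proof (intro integral_le integrable_continuous_real continuous_intros continuous_on_shift_reflect[OF r])
        fix u assume u: "u \<in> {0..\<tau> / 2}"
        let ?x = "\<bar>r (t - u)\<bar>"
        \<comment> \<open>the weighting by \<open>B\<close> keeps the bound homogeneous of degree one in \<open>B\<close>\<close>
        have "0 \<le> (?x - B)\<^sup>2" by simp
        then have "?x \<le> B / 2 + 1 / (2 * B) * ?x\<^sup>2"
          using B by (simp add: field_simps power2_eq_square)
        also have "1 / (2 * B) * ?x\<^sup>2 = 1 / (2 * c * B) * (c * ?x\<^sup>2)" using c by simp
        also have "\<dots> \<le> 1 / (2 * c * B) * (poly \<rho> u * ?x\<^sup>2)"
          using \<rho>_ge[of u] u c B by (intro mult_left_mono mult_right_mono) auto
        finally show "?x \<le> B / 2 + 1 / (2 * c * B) * (poly \<rho> u * (r (t - u))\<^sup>2)" by simp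
      qed
      also have "\<dots> = \<tau> / 2 * (B / 2) + 1 / (2 * c * B) * integral {0..\<tau> / 2} (\<lambda>u. poly \<rho> u * (r (t - u))\<^sup>2)"
        using \<tau> c B by (subst integral_add) (auto intro!: integrable_continuous_real continuous_intros continuous_on_shift_reflect[OF r])
      also have "integral {0..\<tau> / 2} (\<lambda>u. poly \<rho> u * (r (t - u))\<^sup>2) \<le> integral {0..\<tau>} (\<lambda>u. poly \<rho> u * (r (t - u))\<^sup>2)"
        using \<tau> \<rho>_nonneg by (intro integral_subset_le integrable_continuous_real continuous_intros continuous_on_shift_reflect[OF r]) auto
      also have "\<dots> \<le> R * B\<^sup>2" using E by (simp add: r_def Qs)
      finally have "integral {t - h..t} (\<lambda>s. \<bar>(bdiff h ^^ (m + 1)) w s\<bar>) \<le>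
          2 ^ (m + 1) * (\<tau> / 2 * (B / 2) + 1 / (2 * c * B) * (R * B\<^sup>2))"
        using B c by (simp add: mult_left_mono divide_right_mono)
      also have "\<dots> = M * B * 1" using B c by (simp add: M_def power2_eq_square field_simps)
      also have "\<dots> \<le> M * B * exp (\<epsilon> * t)" using M B \<epsilon> that by (intro mult_left_mono) auto
      finally show ?thesis .
    qed
    have win: "integral {t - h..t} (\<lambda>s. \<bar>w s\<bar>) \<le> X * B * exp (\<epsilon> * t)" if "t \<ge> - \<tau>" for t
      using X[OF w, of B t] B wB diff that by auto
    have sum_win: "integral {t - \<tau>..t} (\<lambda>s. \<bar>w s\<bar>) \<le> real N * X * B * exp (\<epsilon> * t)" if "t \<ge> 0" for t
    proof -
      have "k \<le> N \<Longrightarrow> integral {t - real k * h..t} (\<lambda>s. \<bar>w s\<bar>) \<le> real k * X * B * exp (\<epsilon> * t)" for k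
      proof (induction k)
        case (Suc k)
        let ?s = "t - real k * h"
        have "real k * h \<le> real N * h" using Suc.prems h by (intro mult_right_mono) auto
        then have "?s \<ge> - \<tau>" using Nh that by linarith
        have "integral {t - real (Suc k) * h..t} (\<lambda>s. \<bar>w s\<bar>) =
            integral {?s - h..?s} (\<lambda>s. \<bar>w s\<bar>) + integral {?s..t} (\<lambda>s. \<bar>w s\<bar>)"
          using h Henstock_Kurzweil_Integration.integral_combine[of "?s - h" ?s t "\<lambda>s. \<bar>w s\<bar>"] abs_integrable_UNIV[OF w]
          by (simp add: algebra_simps)
        also have "integral {?s - h..?s} (\<lambda>s. \<bar>w s\<bar>) \<le> X * B * exp (\<epsilon> * ?s)" by (rule win) fact
        also have "\<dots> \<le> X * B * exp (\<epsilon> * t)" using \<open>X \<ge> 0\<close> B h \<epsilon> by (intro mult_left_mono) auto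
        finally show ?case using Suc by (simp add: algebra_simps)
      qed simp
      from this[of N] show ?thesis by (simp add: Nh)
    qed
    have "\<bar>w t\<bar> \<le> (B * exp (\<epsilon> * \<tau>) + K * B / (1 - exp (- \<epsilon> * \<tau>))) * exp (\<epsilon> * t)"
    proof (rule exponential_recursion[where f = "\<lambda>t. \<bar>w t\<bar>" and \<tau> = \<tau>])
      fix t :: real assume "t \<ge> 0"
      have "\<bar>wint \<tau> w t (pderiv (\<rho> * J))\<bar> \<le> integral {0..\<tau>} (\<lambda>u. H * \<bar>w (t - u)\<bar>)"
        unfolding wint_def real_norm_def[symmetric]
      proof (rule integral_norm_bound_integral)
        fix u assume "u \<in> {0..\<tau>}"
        then show "norm (poly (pderiv (\<rho> * J)) u * w (t - u)) \<le> H * norm (w (t - u))"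
          using H[of u] by (auto simp: abs_mult intro!: mult_right_mono)
      qed (intro integrable_continuous_real continuous_intros continuous_on_shift_reflect[OF w])+
      also have "\<dots> = H * integral {t - \<tau>..t} (\<lambda>s. \<bar>w s\<bar>)"
        using integral_reflect_shift[of "\<lambda>s. \<bar>w s\<bar>" \<tau> t] w by (simp add: continuous_intros)
      also have "\<dots> \<le> H * (real N * X * B * exp (\<epsilon> * t))"
        using sum_win[OF \<open>t \<ge> 0\<close>] \<open>H \<ge> 0\<close> by (rule mult_left_mono)
      also have "\<dots> = \<bar>b0\<bar> * (K * B * exp (\<epsilon> * t))" using b0 by (simp add: K_def)
      finally have 1: "\<bar>wint \<tau> w t (pderiv (\<rho> * J))\<bar> \<le> \<bar>b0\<bar> * (K * B * exp (\<epsilon> * t))" .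
      have "b0 * w t = poly (\<rho> * J) \<tau> * w (t - \<tau>) - wint \<tau> w t (pderiv (\<rho> * J))"
        using eq \<open>t \<ge> 0\<close> unfolding b0_def by (simp only: eq_diff_eq) (smt (verit))
      then have "\<bar>b0\<bar> * \<bar>w t\<bar> \<le> \<bar>poly (\<rho> * J) \<tau>\<bar> * \<bar>w (t - \<tau>)\<bar> + \<bar>wint \<tau> w t (pderiv (\<rho> * J))\<bar>"
        unfolding abs_mult[symmetric] by (simp only: abs_triangle_ineq4)
      also have "\<dots> \<le> \<bar>b0\<bar> * \<bar>w (t - \<tau>)\<bar> + \<bar>b0\<bar> * (K * B * exp (\<epsilon> * t))"
        using b1 1 by (intro add_mono mult_right_mono) auto
      finally have "\<bar>b0\<bar> * \<bar>w t\<bar> \<le> \<bar>b0\<bar> * (\<bar>w (t - \<tau>)\<bar> + K * B * exp (\<epsilon> * t))"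
        by (simp only: distrib_left)
      then show "\<bar>w t\<bar> \<le> \<bar>w (t - \<tau>)\<bar> + K * B * exp (\<epsilon> * t)" using b0 by simp
    qed (use wB \<epsilon> \<tau> B K t in auto)
    also have "\<dots> = C * B * exp (\<epsilon> * t)" by (simp add: C_def algebra_simps)
    finally show "\<bar>w t\<bar> \<le> C * B * exp (\<epsilon> * t)" .
  qed
qed

end

lemma power_le_exp:
  assumes "\<epsilon> > 0" "x \<ge> 0" "k > 0"
  shows "x ^ k \<le> (real k / \<epsilon>) ^ k * exp (\<epsilon> * x)"
proof -
  have "(\<epsilon> * x / real k) ^ k \<le> exp (\<epsilon> * x / real k) ^ k"
    using assms exp_ge_add_one_self[of "\<epsilon> * x / real k"] by (intro power_mono) (linarith, simp)
  also have "\<dots> = exp (\<epsilon> * x)" using assms by (simp flip: exp_of_nat_mult)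
  finally have "(real k / \<epsilon>) ^ k * (\<epsilon> * x / real k) ^ k \<le> (real k / \<epsilon>) ^ k * exp (\<epsilon> * x)"
    using assms by (intro mult_left_mono) auto
  then show ?thesis using assms by (simp flip: power_mult_distrib)
qed

context delay_window
begin

text \<open>
  Modulo lower powers of \<open>u\<close>, to which \<open>J\<close> is orthogonal, \<open>(t - u)^m\<close> is \<open>(- u)^m\<close>; so the left-hand side
  does not depend on \<open>t\<close>.
\<close>

lemma window_equation_of_power:
  defines "w \<equiv> (\<lambda>s. s ^ (m + 1))"
  shows "poly (\<rho> * J) 0 * w t - poly (\<rho> * J) \<tau> * w (t - \<tau>) + wint \<tau> w t (pderiv (\<rho> * J)) =
    (real m + 1) * (- 1) ^ m * pint \<tau> (\<rho> * J * monom 1 m)"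
proof -
  define P where "P = [:t, -1:] ^ (m + 1)"
  define S where "S = [:t, -1:] ^ m"
  have wint: "wint \<tau> w t f = pint \<tau> (f * P)" for f
    unfolding wint_def pint_def w_def P_def
    by (rule integral_cong) (simp add: poly_power algebra_simps)
  have Pw: "poly P u = w (t - u)" for u
    by (simp add: w_def P_def poly_power algebra_simps)
  have dP: "pderiv P = smult (- (real m + 1)) S"
    unfolding P_def S_def by (simp only: Suc_eq_plus1[symmetric] pderiv_power_Suc) (simp add: pderiv_pCons smult_add_left smult_diff_left)
  have "pderiv (\<rho> * J * P) = pderiv (\<rho> * J) * P + smult (- (real m + 1)) (\<rho> * J * S)"
    by (simp only: pderiv_mult[of "\<rho> * J" P] dP) (simp add: algebra_simps)
  then have "pint \<tau> (pderiv (\<rho> * J) * P) - (real m + 1) * pint \<tau> (\<rho> * J * S) = poly (\<rho> * J * P) \<tau> - poly (\<rho> * J * P) 0"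
    using pint_pderiv[of \<tau> "\<rho> * J * P"] \<tau> by (simp add: pint_add pint_smult algebra_simps del: poly_mult mult_pCons_left)
  then have 1: "poly (\<rho> * J) 0 * w t - poly (\<rho> * J) \<tau> * w (t - \<tau>) + wint \<tau> w t (pderiv (\<rho> * J)) = (real m + 1) * pint \<tau> (\<rho> * J * S)"
    by (simp add: wint Pw del: poly_mult) (simp add: Pw algebra_simps)
  have degS: "degree S \<le> m" unfolding S_def by (rule order_trans[OF degree_power_le]) simp
  have cS: "coeff S m = (- 1) ^ m"
    using lead_coeff_power[of "[:t, -1:]" m] by (simp add: S_def degree_power_eq)
  have "pint \<tau> (\<rho> * J * (S + smult (- ((- 1) ^ m)) (monom 1 m))) = 0"
    by (rule orth) (simp_all only: coeff_add coeff_smult coeff_monom cS, intro degree_add_le degS order_trans[OF degree_smult_le] degree_monom_le, simp)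
  then have "pint \<tau> (\<rho> * J * S) = (- 1) ^ m * pint \<tau> (\<rho> * J * monom 1 m)"
    by (simp only: distrib_left pint_add mult_smult_right pint_smult)
  with 1 show ?thesis by simp
qed

lemma pint_top_degree_nonzero: "pint \<tau> (\<rho> * J * monom 1 m) \<noteq> 0"
proof
  assume z: "pint \<tau> (\<rho> * J * monom 1 m) = 0"
  have "pint \<tau> (\<rho> * J * (J + smult (- coeff J m) (monom 1 m))) = 0"
    by (rule orth) (simp_all only: coeff_add coeff_smult coeff_monom, intro degree_add_le degJ order_trans[OF degree_smult_le] degree_monom_le, simp)
  then have "pint \<tau> (\<rho> * J * J) = 0"
    by (simp only: distrib_left pint_add mult_smult_right pint_smult z)
  moreover have "pint \<tau> (\<rho> * J * J) > 0"
    using J0 by (intro pint_square_pos \<tau> \<rho>_nonneg \<rho>_nz) auto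
  ultimately show False by simp
qed

text \<open>
  By the two preceding lemmas a multiple \<open>\<beta> s^(m + 1)\<close> absorbs the right-hand side \<open>c\<close>. The equation at
  \<open>t = 0\<close> bounds \<open>c\<close>, and hence \<open>\<beta>\<close>, in terms of \<open>B\<close>; the power itself is dominated by \<open>exp (\<epsilon> t)\<close>.
\<close>

lemma inhomogeneous_growth:
  assumes \<epsilon>: "\<epsilon> > 0"
  shows "\<exists>C>0. \<forall>w B c. continuous_on {-\<tau>..} w \<longrightarrow> B > 0 \<longrightarrow> (\<forall>s\<in>{-\<tau>..0}. \<bar>w s\<bar> \<le> B) \<longrightarrow>
    (\<forall>t\<ge>0. poly (\<rho> * J) 0 * w t - poly (\<rho> * J) \<tau> * w (t - \<tau>) + wint \<tau> w t (pderiv (\<rho> * J)) = c) \<longrightarrow>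
    (\<forall>t\<ge>-\<tau>. \<bar>w t\<bar> \<le> C * B * exp (\<epsilon> * t))"
proof -
  obtain C where "C > 0" and C: "\<And>w B t. continuous_on UNIV w \<Longrightarrow> B > 0 \<Longrightarrow> (\<forall>s\<le>0. \<bar>w s\<bar> \<le> B) \<Longrightarrow>
    (\<forall>t\<ge>0. poly (\<rho> * J) 0 * w t - poly (\<rho> * J) \<tau> * w (t - \<tau>) + wint \<tau> w t (pderiv (\<rho> * J)) = 0) \<Longrightarrow>
    t \<ge> -\<tau> \<Longrightarrow> \<bar>w t\<bar> \<le> C * B * exp (\<epsilon> * t)"
    using homogeneous_growth[OF \<epsilon>] by blast
  define \<kappa> where "\<kappa> = (real m + 1) * (- 1) ^ m * pint \<tau> (\<rho> * J * monom 1 m)"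
  have \<kappa>: "\<kappa> \<noteq> 0" using pint_top_degree_nonzero by (simp add: \<kappa>_def)
  define A where "A = \<bar>poly (\<rho> * J) 0\<bar> + \<bar>poly (\<rho> * J) \<tau>\<bar> + integral {0..\<tau>} (\<lambda>u. \<bar>poly (pderiv (\<rho> * J)) u\<bar>)"
  have "integral {0..\<tau>} (\<lambda>u. \<bar>poly (pderiv (\<rho> * J)) u\<bar>) \<ge> 0"
    by (rule integral_nonneg) (auto intro!: integrable_continuous_real continuous_intros)
  then have A: "A \<ge> 0" by (simp add: A_def)
  define b where "b = A / \<bar>\<kappa>\<bar>"
  have b: "b \<ge> 0" using A by (simp add: b_def)
  define K where "K = 1 + b * \<tau> ^ (m + 1)"
  have K: "K > 0" using b \<tau> by (simp add: K_def add_pos_nonneg)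
  define E where "E = (real (m + 1) / \<epsilon>) ^ (m + 1) * exp (\<epsilon> * (2 * \<tau>))"
  have E: "\<bar>t\<bar> ^ (m + 1) \<le> E * exp (\<epsilon> * t)" if "t \<ge> - \<tau>" for t
  proof -
    have "\<bar>t\<bar> ^ (m + 1) \<le> (t + 2 * \<tau>) ^ (m + 1)" using that \<tau> by (intro power_mono) auto
    also have "\<dots> \<le> (real (m + 1) / \<epsilon>) ^ (m + 1) * exp (\<epsilon> * (t + 2 * \<tau>))"
      using that \<tau> by (intro power_le_exp \<epsilon>) auto
    finally show ?thesis by (simp add: E_def exp_add distrib_left mult_ac)
  qed
  have E0: "E > 0" using \<epsilon> by (simp add: E_def)
  define C' where "C' = C * K + b * E"
  show ?thesis
  proof (intro exI[of _ C'] conjI allI impI)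
    show "C' > 0" unfolding C'_def using \<open>C > 0\<close> K b E0 by (intro add_pos_nonneg) auto
    fix w :: "real \<Rightarrow> real" and B c t :: real
    assume w: "continuous_on {-\<tau>..} w" and B: "B > 0" and wB: "\<forall>s\<in>{-\<tau>..0}. \<bar>w s\<bar> \<le> B"
      and eq: "\<forall>t\<ge>0. poly (\<rho> * J) 0 * w t - poly (\<rho> * J) \<tau> * w (t - \<tau>) + wint \<tau> w t (pderiv (\<rho> * J)) = c"
      and t: "- \<tau> \<le> t"
    have "\<bar>wint \<tau> w 0 (pderiv (\<rho> * J))\<bar> \<le> integral {0..\<tau>} (\<lambda>u. \<bar>poly (pderiv (\<rho> * J)) u\<bar> * B)"
      unfolding wint_def real_norm_def[symmetric]
    proof (rule integral_norm_bound_integral)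
      have "continuous_on {0..\<tau>} (\<lambda>u. w (0 - u))"
        by (rule continuous_on_compose2[OF w]) (auto intro!: continuous_intros)
      then show "(\<lambda>u. poly (pderiv (\<rho> * J)) u * w (0 - u)) integrable_on {0..\<tau>}"
        by (intro integrable_continuous_real continuous_intros)
      show "(\<lambda>u. norm (poly (pderiv (\<rho> * J)) u) * B) integrable_on {0..\<tau>}"
        by (intro integrable_continuous_real continuous_intros)
      fix u assume "u \<in> {0..\<tau>}"
      then show "norm (poly (pderiv (\<rho> * J)) u * w (0 - u)) \<le> norm (poly (pderiv (\<rho> * J)) u) * B"
        using wB by (auto simp: abs_mult intro!: mult_left_mono)
    qed
    then have 1: "\<bar>wint \<tau> w 0 (pderiv (\<rho> * J))\<bar> \<le> integral {0..\<tau>} (\<lambda>u. \<bar>poly (pderiv (\<rho> * J)) u\<bar>) * B" by simp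
    have "\<bar>c\<bar> \<le> \<bar>poly (\<rho> * J) 0\<bar> * \<bar>w 0\<bar> + \<bar>poly (\<rho> * J) \<tau>\<bar> * \<bar>w (- \<tau>)\<bar> + \<bar>wint \<tau> w 0 (pderiv (\<rho> * J))\<bar>"
      using eq[rule_format, of 0] unfolding abs_mult[symmetric] by simp
    also have "\<dots> \<le> \<bar>poly (\<rho> * J) 0\<bar> * B + \<bar>poly (\<rho> * J) \<tau>\<bar> * B + integral {0..\<tau>} (\<lambda>u. \<bar>poly (pderiv (\<rho> * J)) u\<bar>) * B"
      using wB \<tau> by (intro add_mono 1 mult_left_mono) auto
    finally have "\<bar>c\<bar> \<le> A * B" by (simp add: A_def algebra_simps)
    define \<beta> where "\<beta> = c / \<kappa>"
    have \<beta>: "\<bar>\<beta>\<bar> \<le> b * B"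
      using \<open>\<bar>c\<bar> \<le> A * B\<close> \<kappa> by (simp add: \<beta>_def b_def abs_divide divide_right_mono)
    \<comment> \<open>constant to the left of \<open>- \<tau>\<close>: continuous on the whole line and bounded for negative times\<close>
    define v where "v s = w (max s (- \<tau>)) - \<beta> * max s (- \<tau>) ^ (m + 1)" for s
    have v: "continuous_on UNIV v"
      unfolding v_def by (intro continuous_intros continuous_on_compose2[OF w]) auto
    have vs: "v s = w s - \<beta> * s ^ (m + 1)" if "s \<ge> - \<tau>" for s using that by (simp add: v_def max_def)
    have "\<bar>v s\<bar> \<le> K * B" if "s \<le> 0" for s
    proof -
      let ?s = "max s (- \<tau>)"
      have s: "?s \<in> {-\<tau>..0}" using that \<tau> by auto
      have "\<bar>v s\<bar> \<le> \<bar>w ?s\<bar> + \<bar>\<beta>\<bar> * \<bar>?s\<bar> ^ (m + 1)"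
        unfolding v_def power_abs[symmetric] abs_mult[symmetric] by (rule abs_triangle_ineq4)
      also have "\<dots> \<le> B + b * B * \<tau> ^ (m + 1)"
      proof (rule add_mono)
        show "\<bar>w ?s\<bar> \<le> B" using wB s by blast
        have "\<bar>?s\<bar> ^ (m + 1) \<le> \<tau> ^ (m + 1)" using s by (intro power_mono) auto
        then show "\<bar>\<beta>\<bar> * \<bar>?s\<bar> ^ (m + 1) \<le> b * B * \<tau> ^ (m + 1)"
          using b B by (intro mult_mono \<beta>) auto
      qed
      finally show ?thesis by (simp add: K_def algebra_simps)
    qed
    moreover have "poly (\<rho> * J) 0 * v t - poly (\<rho> * J) \<tau> * v (t - \<tau>) + wint \<tau> v t (pderiv (\<rho> * J)) = 0" if "t \<ge> 0" for t
    proof -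
      let ?p = "\<lambda>s::real. s ^ (m + 1)"
      have "wint \<tau> v t f = integral {0..\<tau>} (\<lambda>u. poly f u * w (t - u) - \<beta> * (poly f u * ?p (t - u)))" for f
        unfolding wint_def by (rule integral_cong) (use that in \<open>auto simp: vs algebra_simps\<close>)
      also have "\<dots> f = wint \<tau> w t f - \<beta> * wint \<tau> ?p t f" for f
      proof -
        have "continuous_on {0..\<tau>} (\<lambda>u. w (t - u))"
          using that by (intro continuous_on_compose2[OF w]) (auto intro!: continuous_intros)
        then have "integral {0..\<tau>} (\<lambda>u. poly f u * w (t - u) - \<beta> * (poly f u * ?p (t - u))) =
            wint \<tau> w t f - integral {0..\<tau>} (\<lambda>u. \<beta> * (poly f u * ?p (t - u)))"
          unfolding wint_def by (intro integral_diff integrable_continuous_real continuous_intros)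
        then show ?thesis by (simp add: wint_def)
      qed
      finally have wv: "wint \<tau> v t f = wint \<tau> w t f - \<beta> * wint \<tau> ?p t f" for f .
      have "poly (\<rho> * J) 0 * v t - poly (\<rho> * J) \<tau> * v (t - \<tau>) + wint \<tau> v t (pderiv (\<rho> * J)) =
         (poly (\<rho> * J) 0 * w t - poly (\<rho> * J) \<tau> * w (t - \<tau>) + wint \<tau> w t (pderiv (\<rho> * J)))
         - \<beta> * (poly (\<rho> * J) 0 * ?p t - poly (\<rho> * J) \<tau> * ?p (t - \<tau>) + wint \<tau> ?p t (pderiv (\<rho> * J)))"
        unfolding wv using that \<tau> by (simp add: vs algebra_simps)
      also have "\<dots> = c - \<beta> * \<kappa>"
        using eq that unfolding window_equation_of_power \<kappa>_def[symmetric] by simp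
      finally show ?thesis using \<kappa> by (simp add: \<beta>_def)
    qed
    ultimately have "\<bar>v t\<bar> \<le> C * (K * B) * exp (\<epsilon> * t)"
      using v K B t by (intro C) auto
    moreover have "\<bar>w t\<bar> \<le> \<bar>v t\<bar> + \<bar>\<beta>\<bar> * \<bar>t\<bar> ^ (m + 1)"
      unfolding power_abs[symmetric] abs_mult[symmetric] using vs[OF t] by linarith
    moreover have "\<bar>\<beta>\<bar> * \<bar>t\<bar> ^ (m + 1) \<le> b * B * (E * exp (\<epsilon> * t))"
      using b B by (intro mult_mono \<beta> E t) auto
    ultimately have "\<bar>w t\<bar> \<le> C * (K * B) * exp (\<epsilon> * t) + b * B * (E * exp (\<epsilon> * t))" by linarith
    then show "\<bar>w t\<bar> \<le> C' * B * exp (\<epsilon> * t)" by (simp add: C'_def algebra_simps)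
  qed
qed

end

section \<open>The kernel and its Rodrigues formula\<close>

lemma power_dvd_pderiv_funpow:
  fixes l p :: "real poly"
  assumes "l ^ k dvd p"
  shows "l ^ (k - i) dvd (pderiv ^^ i) p"
proof (induction i)
  case 0
  then show ?case using assms by simp
next
  case (Suc i)
  show ?case
  proof (cases "k - i")
    case 0
    then have "k - Suc i = 0" by simp
    then show ?thesis by simp
  next
    case (Suc j)
    obtain q where q: "(pderiv ^^ i) p = l ^ Suc j * q"
      using Suc.IH Suc by (auto elim: dvdE)
    have "k - Suc i = j" using Suc by simp
    moreover have "l ^ j dvd pderiv (l ^ Suc j * q)"
      by (simp only: pderiv_mult pderiv_power_Suc)
         (intro dvd_add dvd_mult dvd_mult2 dvd_smult le_imp_power_dvd; simp)
    ultimately show ?thesis by (simp add: q)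
  qed
qed

lemma pderiv_funpow_eq_0:
  fixes f :: "real poly"
  assumes "degree f \<le> m" "coeff f m = 0"
  shows "(pderiv ^^ m) f = 0"
proof (rule poly_eqI)
  fix i
  show "coeff ((pderiv ^^ m) f) i = coeff 0 i"
    using assms by (cases "i = 0") (auto simp: coeff_higher_pderiv coeff_eq_0)
qed

text \<open>
  With \<open>p = pade_kernel n m \<tau>\<close>, the derivatives of \<open>p\<close> at \<open>0\<close> and at \<open>\<tau>\<close> are, up to normalisation, the
  coefficients of the denominator and the numerator of a Pade approximant of the exponential function.
\<close>

definition pade_kernel :: "nat \<Rightarrow> nat \<Rightarrow> real \<Rightarrow> real poly" where
  "pade_kernel n m \<tau> = monom 1 m * [:\<tau>, -1:] ^ n"

lemma coeff_pade_kernel: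
  "coeff (pade_kernel n m \<tau>) i =
    (if m \<le> i \<and> i \<le> m + n then real (n choose (i - m)) * (- 1) ^ (i - m) * \<tau> ^ (n + m - i) else 0)"
proof -
  have "coeff ([:\<tau>, -1:] ^ n) j = real (n choose j) * (- 1) ^ j * \<tau> ^ (n - j)" if "j \<le> n" for j
    using coeff_linear_poly_power[OF that, of \<tau> "-1"] by (simp add: mult_ac)
  moreover have "coeff ([:\<tau>, -1:] ^ n) j = 0" if "j > n" for j
    by (rule coeff_eq_0) (use that in \<open>simp add: degree_power_eq\<close>)
  ultimately show ?thesis
    by (auto simp: pade_kernel_def coeff_monom_mult)
qed

lemma degree_pade_kernel: "degree (pade_kernel n m \<tau>) = n + m"
  by (simp add: pade_kernel_def degree_mult_eq degree_monom_eq degree_power_eq)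

text \<open>
  Reflection of the window exchanges the two exponents, so that derivatives at \<open>\<tau>\<close> reduce to
  derivatives at \<open>0\<close>.
\<close>

lemma pcompose_pade_kernel: "pcompose (pade_kernel n m \<tau>) [:\<tau>, -1:] = pade_kernel m n \<tau>"
  by (rule poly_eq_poly_eq_iff[THEN iffD1], rule ext)
     (simp add: pade_kernel_def poly_pcompose poly_monom poly_power)

lemma pderiv_funpow_reflect:
  "(pderiv ^^ i) (pcompose p [:\<tau>, -1:]) = smult ((- 1) ^ i) (pcompose ((pderiv ^^ i) p) [:\<tau>, -1:])"
  for p :: "real poly"
  by (induction i) (simp_all add: pderiv_smult pderiv_pcompose pderiv_pCons)

lemma poly_pderiv_funpow_0: "poly ((pderiv ^^ i) p) 0 = fact i * coeff p i" for p :: "real poly"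
  by (simp add: poly_0_coeff_0 coeff_higher_pderiv pochhammer_fact[symmetric])

lemma pade_kernel_deriv_end:
  "poly ((pderiv ^^ i) (pade_kernel n m \<tau>)) \<tau> = (- 1) ^ i * fact i * coeff (pade_kernel m n \<tau>) i"
proof -
  have "(- 1) ^ i * poly ((pderiv ^^ i) (pade_kernel n m \<tau>)) \<tau> =
      poly ((pderiv ^^ i) (pcompose (pade_kernel n m \<tau>) [:\<tau>, -1:])) 0"
    unfolding pderiv_funpow_reflect by (simp add: poly_pcompose)
  also have "\<dots> = fact i * coeff (pade_kernel m n \<tau>) i"
    unfolding pcompose_pade_kernel by (rule poly_pderiv_funpow_0)
  finally have "(- 1) ^ i * ((- 1) ^ i * poly ((pderiv ^^ i) (pade_kernel n m \<tau>)) \<tau>) = (- 1) ^ i * (fact i * coeff (pade_kernel m n \<tau>) i)"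
    by simp
  then show ?thesis by (simp flip: power_add mult.assoc)
qed

text \<open>
  Repeated integration by parts: the derivatives of order below \<open>m \<le> n\<close> vanish at both ends.
\<close>

lemma pint_pade_kernel_deriv:
  assumes "\<tau> \<ge> 0" "m \<le> n" "i \<le> m" "(pderiv ^^ i) f = 0"
  shows "pint \<tau> ((pderiv ^^ i) (pade_kernel n m \<tau>) * f) = 0"
  using assms(3,4)
proof (induction i arbitrary: f)
  case 0
  then show ?case by simp
next
  case (Suc i)
  let ?D = "(pderiv ^^ i) (pade_kernel n m \<tau>)"
  have 0: "poly ?D 0 = 0" using Suc.prems by (simp add: poly_pderiv_funpow_0 coeff_pade_kernel)
  have \<tau>: "poly ?D \<tau> = 0" using Suc.prems \<open>m \<le> n\<close> by (simp add: pade_kernel_deriv_end coeff_pade_kernel)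
  have "(pderiv ^^ i) (pderiv f) = 0"
    using Suc.prems by (simp only: funpow_Suc_right o_apply)
  then have IH: "pint \<tau> (?D * pderiv f) = 0" using Suc.IH Suc.prems by simp
  have "pint \<tau> (pderiv (?D * f)) = 0" using \<open>\<tau> \<ge> 0\<close> 0 \<tau> by (simp add: pint_pderiv)
  also have "pderiv (?D * f) = (pderiv ^^ Suc i) (pade_kernel n m \<tau>) * f + ?D * pderiv f"
    by (simp add: pderiv_mult mult.commute add.commute)
  finally show ?case by (simp add: pint_add IH)
qed

text \<open>
  The formula of Rodrigues: \<open>J\<close> is, up to scaling, a Jacobi polynomial for the weight
  \<open>(\<tau> - u)^(n - m)\<close>, and a Legendre polynomial if \<open>m = n\<close>.
\<close>

lemma pade_kernel_delay_window:
  assumes "\<tau> > 0" "m \<le> n"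
  shows "\<exists>J. (pderiv ^^ m) (pade_kernel n m \<tau>) = [:\<tau>, -1:] ^ (n - m) * J \<and>
    delay_window \<tau> ([:\<tau>, -1:] ^ (n - m)) J m"
proof -
  let ?D = "(pderiv ^^ m) (pade_kernel n m \<tau>)" and ?\<rho> = "[:\<tau>, -1:] ^ (n - m)"
  have "[:\<tau>, -1:] ^ n dvd pade_kernel n m \<tau>" by (simp add: pade_kernel_def)
  then obtain J where J: "?D = ?\<rho> * J"
    using power_dvd_pderiv_funpow by (blast elim: dvdE)
  have D0: "poly ?D 0 = fact m * \<tau> ^ n"
    by (simp add: poly_pderiv_funpow_0 coeff_pade_kernel)
  then have J0: "poly J 0 \<noteq> 0" using \<open>\<tau> > 0\<close> unfolding J by auto
  then have "J \<noteq> 0" by auto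
  then have "degree ?D = (n - m) + degree J"
    unfolding J by (simp add: degree_mult_eq degree_power_eq)
  then have degJ: "degree J \<le> m"
    using \<open>m \<le> n\<close> by (simp add: degree_higher_pderiv degree_pade_kernel)
  have "delay_window \<tau> ?\<rho> J m"
  proof
    fix u :: real assume "0 \<le> u" "u \<le> \<tau>"
    then show "poly (pderiv ?\<rho>) u \<le> 0"
      by (simp add: pderiv_power pderiv_pCons poly_power)
  next
    fix f :: "real poly" assume "degree f \<le> m" "coeff f m = 0"
    then show "pint \<tau> (?\<rho> * J * f) = 0"
      using assms unfolding J[symmetric] by (intro pint_pade_kernel_deriv pderiv_funpow_eq_0) auto
  qed (use assms degJ J0 in \<open>auto simp: poly_power\<close>)
  with J show ?thesis by blast
qed

lemma pade_kernel_growth: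
  assumes "\<tau> > 0" "m \<le> n" "\<epsilon> > 0"
  defines "K i \<equiv> (pderiv ^^ i) (pade_kernel n m \<tau>)"
  shows "\<exists>C>0. \<forall>w B c. continuous_on {-\<tau>..} w \<longrightarrow> B > 0 \<longrightarrow> (\<forall>s\<in>{-\<tau>..0}. \<bar>w s\<bar> \<le> B) \<longrightarrow>
    (\<forall>t\<ge>0. poly (K m) 0 * w t - poly (K m) \<tau> * w (t - \<tau>) + wint \<tau> w t (K (Suc m)) = c) \<longrightarrow>
    (\<forall>t\<ge>-\<tau>. \<bar>w t\<bar> \<le> C * B * exp (\<epsilon> * t))"
proof -
  obtain J where J: "K m = [:\<tau>, -1:] ^ (n - m) * J" and d: "delay_window \<tau> ([:\<tau>, -1:] ^ (n - m)) J m"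
    using pade_kernel_delay_window[OF assms(1,2)] unfolding K_def by blast
  have "K (Suc m) = pderiv (K m)" by (simp add: K_def)
  then show ?thesis
    using delay_window.inhomogeneous_growth[OF d \<open>\<epsilon> > 0\<close>] unfolding J by simp
qed

section \<open>The operator (D - c)^j\<close>

text \<open>
  If \<open>b\<close> lists the derivatives of a function, \<open>shift_op c j b\<close> is the value of \<open>(D - c)^j\<close> applied to it;
  \<open>exp (- c t)\<close> times this is the \<open>j\<close>-th derivative of \<open>exp (- c t)\<close> times the function. Working with
  the list of values, rather than with derivatives of functions, covers the neutral equation,
  where the entry of order \<open>n\<close> need not be a derivative.
\<close>

primrec shift_op :: "real \<Rightarrow> nat \<Rightarrow> (nat \<Rightarrow> real) \<Rightarrow> real" where
  "shift_op c 0 b = b 0"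
| "shift_op c (Suc j) b = shift_op c j (\<lambda>i. b (Suc i)) - c * shift_op c j b"

lemma shift_op_cong: "(\<And>i. i \<le> j \<Longrightarrow> b i = b' i) \<Longrightarrow> shift_op c j b = shift_op c j b'"
proof (induction j arbitrary: b b')
  case (Suc j)
  have "shift_op c j (\<lambda>i. b (Suc i)) = shift_op c j (\<lambda>i. b' (Suc i))" "shift_op c j b = shift_op c j b'"
    using Suc.prems by (intro Suc.IH; simp)+
  then show ?case by simp
qed simp

lemma shift_op_add: "shift_op c j (\<lambda>i. b i + b' i) = shift_op c j b + shift_op c j b'"
  by (induction j arbitrary: b b') (auto simp: algebra_simps)

lemma shift_op_mult: "shift_op c j (\<lambda>i. x * b i) = x * shift_op c j b"
  by (induction j arbitrary: b) (auto simp: algebra_simps)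

lemma shift_op_diff: "shift_op c j (\<lambda>i. b i - b' i) = shift_op c j b - shift_op c j b'"
  using shift_op_add[of c j "\<lambda>i. b i - b' i" b'] by simp

lemma shift_op_inverse: "shift_op (- c) j (\<lambda>i. shift_op c i b) = b j"
  by (induction j arbitrary: b) (auto simp: shift_op_diff shift_op_mult)

lemma shift_op_geometric: "shift_op c j (\<lambda>i. x * c ^ i) = (if j = 0 then x else 0)"
  by (induction j arbitrary: x) (simp_all add: shift_op_mult mult.left_commute mult.assoc)

lemma shift_op_bound:
  assumes "\<And>i. i \<le> j \<Longrightarrow> \<bar>b i\<bar> \<le> B"
  shows "\<bar>shift_op c j b\<bar> \<le> (1 + \<bar>c\<bar>) ^ j * B"
  using assms
proof (induction j arbitrary: b)
  case (Suc j)
  have "\<bar>shift_op c (Suc j) b\<bar> \<le> \<bar>shift_op c j (\<lambda>i. b (Suc i))\<bar> + \<bar>c\<bar> * \<bar>shift_op c j b\<bar>"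
    by (simp add: abs_triangle_ineq4 flip: abs_mult)
  also have "\<dots> \<le> (1 + \<bar>c\<bar>) ^ j * B + \<bar>c\<bar> * ((1 + \<bar>c\<bar>) ^ j * B)"
    using Suc.prems by (intro add_mono mult_left_mono Suc.IH) auto
  finally show ?case by (simp add: algebra_simps)
qed simp

lemma shift_op_has_derivative:
  assumes "\<And>i. i \<le> j \<Longrightarrow> ((\<lambda>t. b t i) has_real_derivative b' i) (at x within A)"
  shows "((\<lambda>t. shift_op c j (b t)) has_real_derivative shift_op c j b') (at x within A)"
  using assms
proof (induction j arbitrary: b b')
  case (Suc j)
  have "((\<lambda>t. shift_op c j (\<lambda>i. b t (Suc i))) has_real_derivative shift_op c j (\<lambda>i. b' (Suc i))) (at x within A)"
    "((\<lambda>t. shift_op c j (b t)) has_real_derivative shift_op c j b') (at x within A)"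
    using Suc.prems by (intro Suc.IH; simp)+
  then show ?case unfolding shift_op.simps by (intro DERIV_diff DERIV_cmult)
qed simp

lemma continuous_on_shift_op:
  assumes "\<And>i. i \<le> j \<Longrightarrow> continuous_on A (\<lambda>t. b t i)"
  shows "continuous_on A (\<lambda>t. shift_op c j (b t))"
  using assms
proof (induction j arbitrary: b)
  case (Suc j)
  have "continuous_on A (\<lambda>t. shift_op c j (\<lambda>i. b t (Suc i)))" "continuous_on A (\<lambda>t. shift_op c j (b t))"
    using Suc.prems by (intro Suc.IH; simp)+
  then show ?case by (auto intro!: continuous_intros)
qed simp

lemma shift_op_eq_sum:
  "shift_op c j b = (\<Sum>i\<le>j. real (j choose i) * (- c) ^ (j - i) * b i)"
proof (induction j arbitrary: b)
  case (Suc j)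
  let ?f = "\<lambda>i. real (j choose i) * (- c) ^ (Suc j - i) * b i"
  have "- c * shift_op c j b = (\<Sum>i\<le>j. ?f i)"
    unfolding Suc.IH sum_distrib_left by (rule sum.cong) (auto simp: Suc_diff_le)
  also have "\<dots> = (\<Sum>i\<le>Suc j. ?f i)" by simp
  also have "\<dots> = ?f 0 + (\<Sum>i\<le>j. ?f (Suc i))" by (rule sum.atMost_Suc_shift)
  finally have "shift_op c (Suc j) b = (\<Sum>i\<le>j. real (j choose i) * (- c) ^ (j - i) * b (Suc i)) + (?f 0 + (\<Sum>i\<le>j. ?f (Suc i)))"
    by (simp add: Suc.IH)
  also have "\<dots> = real (Suc j choose 0) * (- c) ^ (Suc j - 0) * b 0 +
      (\<Sum>i\<le>j. real (Suc j choose Suc i) * (- c) ^ (Suc j - Suc i) * b (Suc i))"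
    by (simp add: algebra_simps sum.distrib)
  also have "\<dots> = (\<Sum>i\<le>Suc j. real (Suc j choose i) * (- c) ^ (Suc j - i) * b i)"
    by (rule sum.atMost_Suc_shift[symmetric])
  finally show ?case .
qed simp

text \<open>
  The expansion of a polynomial in \<open>s - c\<close> into powers of \<open>s\<close>.
\<close>

lemma sum_shift_op:
  "(\<Sum>j\<le>n. \<beta> j * shift_op c j b) = (\<Sum>k\<le>n. (\<Sum>j=k..n. real (j choose k) * (- c) ^ (j - k) * \<beta> j) * b k)"
proof -
  have "(\<Sum>j\<le>n. \<beta> j * shift_op c j b) = (\<Sum>j\<le>n. \<Sum>k\<le>j. real (j choose k) * (- c) ^ (j - k) * \<beta> j * b k)"
    by (simp add: shift_op_eq_sum sum_distrib_left mult_ac)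
  also have "\<dots> = (\<Sum>k\<le>n. \<Sum>j=k..n. real (j choose k) * (- c) ^ (j - k) * \<beta> j * b k)"
    by (induction n) (auto simp: sum.distrib)
  finally show ?thesis by (simp add: sum_distrib_right)
qed

section \<open>A first integral of the equation\<close>

lemma wint_by_parts:
  assumes \<tau>: "\<tau> \<ge> 0" and t: "t \<ge> 0"
    and deriv: "\<And>s. s \<ge> -\<tau> \<Longrightarrow> (F has_real_derivative F' s) (at s within {-\<tau>..})"
    and cont: "continuous_on {-\<tau>..} F'"
  shows "wint \<tau> F' t f = poly f 0 * F t - poly f \<tau> * F (t - \<tau>) + wint \<tau> F t (pderiv f)"
proof -
  have F: "continuous_on {-\<tau>..} F"
    using deriv by (auto simp: continuous_on_eq_continuous_within intro: DERIV_continuous)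
  have cF: "continuous_on {0..\<tau>} (\<lambda>u. F (t - u))" and cF': "continuous_on {0..\<tau>} (\<lambda>u. F' (t - u))"
    using t by (auto intro!: continuous_on_compose2[OF F] continuous_on_compose2[OF cont] continuous_intros)
  have "((\<lambda>u. poly (pderiv f) u * F (t - u) - poly f u * F' (t - u)) has_integral
      poly f \<tau> * F (t - \<tau>) - poly f 0 * F (t - 0)) {0..\<tau>}"
  proof (rule fundamental_theorem_of_calculus[OF \<tau>])
    fix u assume u: "u \<in> {0..\<tau>}"
    have "((\<lambda>u. F (t - u)) has_real_derivative - F' (t - u)) (at u within {0..\<tau>})"
    proof -
      have "(F has_real_derivative F' (t - u)) (at (t - u) within {-\<tau>..})" using u t by (intro deriv) auto
      then have "(F has_real_derivative F' (t - u)) (at (t - u) within (\<lambda>u. t - u) ` {0..\<tau>})"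
        by (rule DERIV_subset) (use t in auto)
      moreover have "((\<lambda>u. t - u) has_real_derivative -1) (at u within {0..\<tau>})"
        by (auto intro!: derivative_eq_intros)
      ultimately show ?thesis using DERIV_image_chain[of F "F' (t - u)" "\<lambda>u. t - u" u "{0..\<tau>}" "-1"] by (simp add: o_def)
    qed
    moreover have "(poly f has_real_derivative poly (pderiv f) u) (at u within {0..\<tau>})"
      by (rule has_field_derivative_at_within[OF poly_DERIV])
    ultimately have "((\<lambda>u. poly f u * F (t - u)) has_real_derivative (poly (pderiv f) u * F (t - u) - poly f u * F' (t - u))) (at u within {0..\<tau>})"
      by (auto intro!: derivative_eq_intros)
    then show "((\<lambda>u. poly f u * F (t - u)) has_vector_derivative (poly (pderiv f) u * F (t - u) - poly f u * F' (t - u))) (at u within {0..\<tau>})"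
      by (simp add: has_real_derivative_iff_has_vector_derivative)
  qed
  then have "integral {0..\<tau>} (\<lambda>u. poly (pderiv f) u * F (t - u) - poly f u * F' (t - u)) = poly f \<tau> * F (t - \<tau>) - poly f 0 * F t"
    by (simp add: integral_unique)
  moreover have "integral {0..\<tau>} (\<lambda>u. poly (pderiv f) u * F (t - u) - poly f u * F' (t - u)) = wint \<tau> F t (pderiv f) - wint \<tau> F' t f"
    unfolding wint_def by (intro integral_diff integrable_continuous_real continuous_intros cF cF')
  ultimately show ?thesis by simp
qed

text \<open>
  Integrating by parts moves the derivatives from \<open>Z p\<close> to the kernel until the kernel is
  exhausted. The boundary terms are the terms of the delay equation, so they cancel against the
  derivative of the first two summands. The highest derivative of \<open>Z\<close> enters only through the difference
  whose derivative \<open>eq\<close> prescribes, as the neutral case requires.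
\<close>

lemma pade_kernel_first_integral:
  fixes Z :: "nat \<Rightarrow> real \<Rightarrow> real" and n m p :: nat and \<tau> :: real
  defines "K \<equiv> (\<lambda>i. (pderiv ^^ i) (pade_kernel n m \<tau>))"
  assumes \<tau>: "\<tau> > 0" and n: "n = Suc p"
    and deriv: "\<And>k s. k < p \<Longrightarrow> s \<ge> -\<tau> \<Longrightarrow> (Z k has_real_derivative Z (Suc k) s) (at s within {-\<tau>..})"
    and cont: "continuous_on {-\<tau>..} (Z p)"
    and eq: "\<And>t. t \<ge> 0 \<Longrightarrow> ((\<lambda>t. poly (K m) 0 * Z p t - poly (K m) \<tau> * Z p (t - \<tau>)) has_real_derivative
        - (\<Sum>k<n. poly (K (n + m - k)) 0 * Z k t - poly (K (n + m - k)) \<tau> * Z k (t - \<tau>))) (at t within {0..})"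
  shows "\<exists>c. \<forall>t\<ge>0. poly (K m) 0 * Z p t - poly (K m) \<tau> * Z p (t - \<tau>) + wint \<tau> (Z p) t (K (Suc m)) = c"
proof -
  have KSuc: "pderiv (K i) = K (Suc i)" for i by (simp add: K_def)
  have contZ: "continuous_on {-\<tau>..} (Z j)" if "j \<le> p" for j
  proof (cases "j = p")
    case False
    then show ?thesis using deriv[of j] that
      by (auto simp: continuous_on_eq_continuous_within intro: DERIV_continuous)
  qed (use cont in simp)
  have parts: "wint \<tau> (Z j) t (K (Suc (n + m) - j)) =
      (\<Sum>k<j. poly (K (n + m - k)) 0 * Z k t - poly (K (n + m - k)) \<tau> * Z k (t - \<tau>))"
    if "j \<le> p" "t \<ge> 0" for j t
    using that(1)
  proof (induction j)
    case 0
    have "K (Suc (n + m)) = 0"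
      unfolding K_def by (rule pderiv_funpow_eq_0) (simp_all add: degree_pade_kernel coeff_eq_0)
    then show ?case by simp
  next
    case (Suc j)
    have 1: "wint \<tau> (Z (Suc j)) t (K (n + m - j)) =
       poly (K (n + m - j)) 0 * Z j t - poly (K (n + m - j)) \<tau> * Z j (t - \<tau>) + wint \<tau> (Z j) t (pderiv (K (n + m - j)))"
      using \<tau> \<open>t \<ge> 0\<close> Suc.prems by (intro wint_by_parts deriv contZ) auto
    have "pderiv (K (n + m - j)) = K (Suc (n + m) - j)"
      using Suc.prems n by (simp add: KSuc Suc_diff_le)
    with 1 Suc show ?case by simp
  qed
  define v where "v s = Z p (max s (- \<tau>))" for s
  have v: "continuous_on UNIV v"
    unfolding v_def by (intro continuous_intros continuous_on_compose2[OF cont]) auto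
  have vZ: "v s = Z p s" if "s \<ge> - \<tau>" for s using that by (simp add: v_def max_def)
  have wintv: "wint \<tau> v t f = wint \<tau> (Z p) t f" if "t \<ge> 0" for t f
    unfolding wint_def by (rule integral_cong) (use that in \<open>auto simp: vZ\<close>)
  have "\<exists>c. \<forall>t\<in>{0..}. poly (K m) 0 * Z p t - poly (K m) \<tau> * Z p (t - \<tau>) + wint \<tau> v t (K (Suc m)) = c"
  proof (rule has_field_derivative_zero_constant)
    fix t :: real assume "t \<in> {0..}"
    then have t: "t \<ge> 0" by simp
    have "(\<Sum>k<n. poly (K (n + m - k)) 0 * Z k t - poly (K (n + m - k)) \<tau> * Z k (t - \<tau>)) =
        (\<Sum>k<p. poly (K (n + m - k)) 0 * Z k t - poly (K (n + m - k)) \<tau> * Z k (t - \<tau>)) +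
        (poly (K (Suc m)) 0 * Z p t - poly (K (Suc m)) \<tau> * Z p (t - \<tau>))"
      by (simp add: n)
    also have "\<dots> = poly (K (Suc m)) 0 * v t - poly (K (Suc m)) \<tau> * v (t - \<tau>) + wint \<tau> v t (pderiv (K (Suc m)))"
      using parts[of p t] t \<tau> by (simp add: n KSuc wintv vZ)
    finally have s: "- (\<Sum>k<n. poly (K (n + m - k)) 0 * Z k t - poly (K (n + m - k)) \<tau> * Z k (t - \<tau>)) +
       (poly (K (Suc m)) 0 * v t - poly (K (Suc m)) \<tau> * v (t - \<tau>) + wint \<tau> v t (pderiv (K (Suc m)))) = 0" by simp
    have "((\<lambda>t. poly (K m) 0 * Z p t - poly (K m) \<tau> * Z p (t - \<tau>) + wint \<tau> v t (K (Suc m))) has_real_derivative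
        - (\<Sum>k<n. poly (K (n + m - k)) 0 * Z k t - poly (K (n + m - k)) \<tau> * Z k (t - \<tau>)) +
        (poly (K (Suc m)) 0 * v t - poly (K (Suc m)) \<tau> * v (t - \<tau>) + wint \<tau> v t (pderiv (K (Suc m))))) (at t within {0..})"
      by (rule DERIV_add[OF eq[OF t] has_field_derivative_at_within[OF wint_has_derivative[OF v less_imp_le[OF \<tau>]]]])
    then show "((\<lambda>t. poly (K m) 0 * Z p t - poly (K m) \<tau> * Z p (t - \<tau>) + wint \<tau> v t (K (Suc m))) has_real_derivative 0) (at t within {0..})"
      unfolding s .
  qed auto
  then show ?thesis using wintv by auto
qed

section \<open>The coefficients of the equation\<close>

text \<open>
  The coefficients of the equation for \<open>s0 = 0\<close>, of the undelayed and of the delayed terms. For other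
  values of \<open>s0\<close> the characteristic function is shifted by \<open>s0\<close>; this is \<open>sum_shift_op\<close>.
\<close>

definition pade_coeff :: "nat \<Rightarrow> nat \<Rightarrow> real \<Rightarrow> nat \<Rightarrow> real" where
  "pade_coeff n m \<tau> k = poly ((pderiv ^^ (n + m - k)) (pade_kernel n m \<tau>)) 0 / (fact m * \<tau> ^ n)"

definition pade_delay_coeff :: "nat \<Rightarrow> nat \<Rightarrow> real \<Rightarrow> nat \<Rightarrow> real" where
  "pade_delay_coeff n m \<tau> k = - poly ((pderiv ^^ (n + m - k)) (pade_kernel n m \<tau>)) \<tau> / (fact m * \<tau> ^ n)"

lemma pade_coeff_eq:
  assumes "k \<le> n" "\<tau> > 0"
  shows "pade_coeff n m \<tau> k = (- 1) ^ (n - k) * fact n * real ((m + n - k) choose m) / (fact k * \<tau> ^ (n - k))"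
proof -
  have "n + m - k - m = n - k" "n + m - (n + m - k) = k" "m + n - k = n + m - k" "m \<le> n + m - k" "n + m - k \<le> m + n"
    using assms by auto
  moreover have "\<tau> ^ n = \<tau> ^ k * \<tau> ^ (n - k)" using assms by (simp flip: power_add)
  moreover have "real (n choose (n - k)) = fact n / (fact k * fact (n - k))"
    using assms by (simp add: binomial_fact mult.commute)
  moreover have "real ((n + m - k) choose m) = fact (n + m - k) / (fact m * fact (n - k))"
    using assms by (simp add: binomial_fact)
  ultimately show ?thesis
    using assms by (simp only: pade_coeff_def poly_pderiv_funpow_0 coeff_pade_kernel) (simp add: mult_ac)
qed

lemma pade_coeff_top: "\<tau> > 0 \<Longrightarrow> pade_coeff n m \<tau> n = 1"
  by (simp add: pade_coeff_eq)

lemma pade_delay_coeff_eq: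
  assumes "k \<le> m" "m \<le> n" "n > 0" "\<tau> > 0"
  shows "pade_delay_coeff n m \<tau> k = (- 1) ^ (n - 1) * fact (m + n - k) / (fact k * fact (m - k) * \<tau> ^ (n - k))"
proof -
  have "n + m - k - n = m - k" "m + n - (n + m - k) = k" "m + n - k = n + m - k" "n \<le> n + m - k" "n + m - k \<le> n + m"
    using assms by auto
  moreover have "\<tau> ^ n = \<tau> ^ k * \<tau> ^ (n - k)" using assms by (simp flip: power_add)
  moreover have "real (m choose (m - k)) = fact m / (fact k * fact (m - k))"
    using assms by (simp add: binomial_fact mult.commute)
  moreover have sign: "- ((- 1) ^ (n + m - k) * (- 1) ^ (m - k)) = ((- 1) ^ (n - 1) :: real)"
  proof -
    obtain d where d: "m = k + d" using \<open>k \<le> m\<close> le_Suc_ex by blast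
    obtain q where q: "n = Suc q" using \<open>n > 0\<close> gr0_implies_Suc by blast
    have "(- 1) ^ d * (- 1) ^ d = (1 :: real)" by (simp flip: power_mult_distrib)
    then show ?thesis by (simp add: d q power_add)
  qed
  ultimately show ?thesis
    using assms unfolding sign[symmetric]
    by (simp only: pade_delay_coeff_def pade_kernel_deriv_end coeff_pade_kernel) (simp add: mult_ac)
qed

lemma pade_delay_coeff_eq_0: "m < k \<Longrightarrow> k \<le> n \<Longrightarrow> pade_delay_coeff n m \<tau> k = 0"
  by (simp add: pade_delay_coeff_def pade_kernel_deriv_end coeff_pade_kernel)

text \<open>
  The derivative of the kernel of order \<open>n + m\<close> is constant. The identity says that \<open>0\<close> is a root of the
  characteristic function for \<open>s0 = 0\<close>.
\<close>

lemma pade_coeff_0_sum: "pade_coeff n m \<tau> 0 + pade_delay_coeff n m \<tau> 0 = 0"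
proof -
  have "degree ((pderiv ^^ (n + m)) (pade_kernel n m \<tau>)) = 0"
    by (simp add: degree_higher_pderiv degree_pade_kernel)
  then obtain c where "(pderiv ^^ (n + m)) (pade_kernel n m \<tau>) = [:c:]" by (metis degree_eq_zeroE)
  then show ?thesis by (simp add: pade_coeff_def pade_delay_coeff_def)
qed

section \<open>Exponential functions on a half-line\<close>

lemma at_within_Ici_neq_bot:
  fixes t :: real
  assumes "a \<le> t"
  shows "at t within {a..} \<noteq> bot"
proof -
  have "at_right t \<le> at t within {a..}" by (rule at_le) (use assms in auto)
  then show ?thesis using trivial_limit_at_right_real[of t] le_bot by metis
qed

lemma deriv_on_exponential:
  assumes f: "\<And>t. t \<ge> a \<Longrightarrow> f t = c * exp (d * t)" and "t \<ge> a"
  shows "deriv_on {a..} j f t = c * d ^ j * exp (d * t)"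
  using \<open>t \<ge> a\<close>
proof (induction j arbitrary: t)
  case 0
  then show ?case using f by simp
next
  case (Suc j)
  have "((\<lambda>t. c * d ^ j * exp (d * t)) has_vector_derivative c * d ^ Suc j * exp (d * t)) (at t within {a..})"
    unfolding has_real_derivative_iff_has_vector_derivative[symmetric]
    by (auto intro!: derivative_eq_intros)
  then have "(deriv_on {a..} j f has_vector_derivative c * d ^ Suc j * exp (d * t)) (at t within {a..})"
    by (rule has_vector_derivative_transform[rotated 2]) (use Suc in auto)
  then show ?case
    using at_within_Ici_neq_bot[OF Suc.prems] by (simp add: vector_derivative_within)
qed

lemma class_C_on_exponential:
  assumes f: "\<And>t. t \<ge> a \<Longrightarrow> f t = c * exp (d * t)"
  shows "class_C_on k {a..} f"
proof -
  have e: "deriv_on {a..} j f t = c * d ^ j * exp (d * t)" if "t \<ge> a" for t j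
    by (rule deriv_on_exponential[OF f that])
  have "deriv_on {a..} j f differentiable_on {a..}" for j
    unfolding differentiable_on_def
  proof
    fix t assume "t \<in> {a..}"
    have "((\<lambda>t. c * d ^ j * exp (d * t)) has_vector_derivative c * d ^ Suc j * exp (d * t)) (at t within {a..})"
      unfolding has_real_derivative_iff_has_vector_derivative[symmetric]
      by (auto intro!: derivative_eq_intros)
    then have "(deriv_on {a..} j f has_vector_derivative c * d ^ Suc j * exp (d * t)) (at t within {a..})"
      by (rule has_vector_derivative_transform[rotated 2]) (use e \<open>t \<in> {a..}\<close> in auto)
    then show "deriv_on {a..} j f differentiable at t within {a..}"
      by (rule differentiableI_vector)
  qed
  then show ?thesis
    unfolding class_C_on_def by (auto intro: differentiable_imp_continuous_on)
qed

lemma derivative_exponential_growth: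
  fixes f f' :: "real \<Rightarrow> real"
  assumes "\<epsilon> > 0" and t: "t \<ge> 0"
    and f: "\<And>s. s \<ge> 0 \<Longrightarrow> (f has_real_derivative f' s) (at s)"
    and f': "\<And>s. s \<ge> 0 \<Longrightarrow> \<bar>f' s\<bar> \<le> A * exp (\<epsilon> * s)"
  shows "\<bar>f t\<bar> \<le> (\<bar>f 0\<bar> + A / \<epsilon>) * exp (\<epsilon> * t)"
proof -
  have "A \<ge> 0" using f'[of 0] by simp
  define X where "X = A / \<epsilon> * exp (\<epsilon> * t)"
  have up: "x * f t \<le> \<bar>f 0\<bar> + X" if "\<bar>x\<bar> = 1" for x
  proof -
    have "A / \<epsilon> * exp (\<epsilon> * 0) - x * f 0 \<le> A / \<epsilon> * exp (\<epsilon> * t) - x * f t"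
  proof (rule DERIV_nonneg_imp_nondecreasing[OF t])
    fix s assume s: "0 \<le> s" "s \<le> t"
    have "x * f' s \<le> \<bar>x * f' s\<bar>" by simp
    also have "\<dots> \<le> A * exp (\<epsilon> * s)" using f'[of s] s that by (simp add: abs_mult)
    finally show "\<exists>y. ((\<lambda>t. A / \<epsilon> * exp (\<epsilon> * t) - x * f t) has_real_derivative y) (at s) \<and> 0 \<le> y"
      using s \<open>\<epsilon> > 0\<close> by (intro exI[of _ "A * exp (\<epsilon> * s) - x * f' s"]) (auto intro!: derivative_eq_intros f)
    qed
    moreover have "A / \<epsilon> \<ge> 0" using \<open>A \<ge> 0\<close> \<open>\<epsilon> > 0\<close> by simp
    moreover have "x * f 0 \<le> \<bar>f 0\<bar>" using that by (metis abs_ge_self abs_mult mult_1)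
    ultimately show ?thesis unfolding X_def by simp
  qed
  have "\<bar>f t\<bar> \<le> \<bar>f 0\<bar> + A / \<epsilon> * exp (\<epsilon> * t)"
    using up[of 1] up[of "-1"] unfolding X_def[symmetric] by (simp add: abs_le_iff)
  also have "\<dots> \<le> \<bar>f 0\<bar> * exp (\<epsilon> * t) + A / \<epsilon> * exp (\<epsilon> * t)"
    using t \<open>\<epsilon> > 0\<close> mult_left_mono[of 1 "exp (\<epsilon> * t)" "\<bar>f 0\<bar>"] by simp
  finally show ?thesis by (simp add: distrib_right)
qed

section \<open>Instability for nonnegative s0\<close>

text \<open>
  The hypotheses of the theorem in the form in which they are used: both groups of coefficients arise
  from those for \<open>s0 = 0\<close> by the shift of the characteristic function by \<open>s0\<close>.
\<close>

locale mid_equation =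
  fixes n m p :: nat and \<tau> s0 :: real and a \<alpha> :: "nat \<Rightarrow> real"
  assumes n: "n = Suc p" and mn: "m \<le> n" and \<tau>: "\<tau> > 0"
    and a_eq: "\<And>k. k < n \<Longrightarrow>
      a k = (\<Sum>j=k..n. real (j choose k) * (- s0) ^ (j - k) * pade_coeff n m \<tau> j)"
    and \<alpha>_eq: "\<And>k. k \<le> m \<Longrightarrow>
      \<alpha> k = (\<Sum>j=k..n. real (j choose k) * (- s0) ^ (j - k) * (exp (s0 * \<tau>) * pade_delay_coeff n m \<tau> j))"
begin

abbreviation "\<nu> \<equiv> neutral_coeff n m \<alpha>"

text \<open>
  Here and in \<open>delayed_shift\<close>, the sequence represents the derivatives of a solution at one instant. Its entry
  of order \<open>n\<close> stands apart, since the solution need not have a derivative of that order.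
\<close>

lemma undelayed_shift:
  "(\<Sum>j\<le>n. pade_coeff n m \<tau> j * shift_op s0 j b) = (\<Sum>k<n. a k * b k) + b n"
proof -
  have "(\<Sum>j\<le>n. pade_coeff n m \<tau> j * shift_op s0 j b) =
      (\<Sum>k<Suc n. (\<Sum>j=k..n. real (j choose k) * (- s0) ^ (j - k) * pade_coeff n m \<tau> j) * b k)"
    unfolding lessThan_Suc_atMost by (rule sum_shift_op)
  also have "\<dots> = (\<Sum>k<n. (\<Sum>j=k..n. real (j choose k) * (- s0) ^ (j - k) * pade_coeff n m \<tau> j) * b k) + b n"
    using \<tau> by (simp add: pade_coeff_top)
  finally show ?thesis by (simp add: a_eq)
qed

lemma neutral_coeff_eq: "\<nu> = exp (s0 * \<tau>) * pade_delay_coeff n m \<tau> n"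
proof (cases "m = n")
  case True
  then have "\<alpha> n = (\<Sum>j=n..n. real (j choose n) * (- s0) ^ (j - n) * (exp (s0 * \<tau>) * pade_delay_coeff n m \<tau> j))"
    by (intro \<alpha>_eq) simp
  with True show ?thesis by (simp only: neutral_coeff_def) simp
next
  case False
  then have "pade_delay_coeff n m \<tau> n = 0" using mn by (intro pade_delay_coeff_eq_0) auto
  with False show ?thesis by (simp only: neutral_coeff_def) simp
qed

lemma delayed_shift:
  "exp (s0 * \<tau>) * (\<Sum>j\<le>n. pade_delay_coeff n m \<tau> j * shift_op s0 j d) =
    (\<Sum>k | k \<le> m \<and> k < n. \<alpha> k * d k) + \<nu> * d n"
proof -
  let ?c = "\<lambda>k. \<Sum>j=k..n. real (j choose k) * (- s0) ^ (j - k) * (exp (s0 * \<tau>) * pade_delay_coeff n m \<tau> j)"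
  have c: "?c k = (if k \<le> m then \<alpha> k else 0)" if "k \<le> n" for k
    using \<alpha>_eq[of k] by (auto simp: pade_delay_coeff_eq_0)
  have "exp (s0 * \<tau>) * (\<Sum>j\<le>n. pade_delay_coeff n m \<tau> j * shift_op s0 j d) =
      (\<Sum>j\<le>n. (exp (s0 * \<tau>) * pade_delay_coeff n m \<tau> j) * shift_op s0 j d)"
    by (simp add: sum_distrib_left mult.assoc)
  also have "\<dots> = (\<Sum>k\<le>n. ?c k * d k)" by (rule sum_shift_op)
  also have "\<dots> = (\<Sum>k<n. (if k \<le> m then \<alpha> k else 0) * d k) + (if n \<le> m then \<alpha> n else 0) * d n"
  proof -
    have "(\<Sum>k\<le>n. ?c k * d k) = (\<Sum>k\<le>n. (if k \<le> m then \<alpha> k else 0) * d k)"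
      by (rule sum.cong) (auto simp: c)
    then show ?thesis by (simp only: lessThan_Suc_atMost[symmetric] sum.lessThan_Suc)
  qed
  also have "(if n \<le> m then \<alpha> n else 0) = \<nu>" using mn by (auto simp: neutral_coeff_def)
  also have "(\<Sum>k<n. (if k \<le> m then \<alpha> k else 0) * d k) = (\<Sum>k | k \<le> m \<and> k < n. \<alpha> k * d k)"
    by (rule sum.mono_neutral_cong_right) auto
  finally show ?thesis .
qed

text \<open>
  The sequence \<open>s0^k\<close> is annihilated by \<open>shift_op s0 j\<close> unless \<open>j = 0\<close>, so only the coefficients of order
  \<open>0\<close> remain, and these cancel.
\<close>

lemma exponential_solution: "dde_solution n m \<tau> a \<alpha> (\<lambda>t. exp (s0 * t))"
proof -
  let ?y = "\<lambda>t. exp (s0 * t)"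
  have D: "deriv_on {-\<tau>..} k ?y t = s0 ^ k * exp (s0 * t)" if "t \<ge> - \<tau>" for k t
    using deriv_on_exponential[of "-\<tau>" ?y 1 s0 t k] that by simp
  have e: "exp (s0 * (t - \<tau>)) = exp (s0 * t) * exp (- (s0 * \<tau>))" for t
    by (simp add: algebra_simps flip: exp_add)
  have delta: "(\<Sum>j\<le>n. \<beta> j * shift_op s0 j (\<lambda>k. x * s0 ^ k)) = \<beta> 0 * x" for \<beta> x
  proof -
    have "(\<Sum>j\<le>n. \<beta> j * shift_op s0 j (\<lambda>k. x * s0 ^ k)) = (\<Sum>j\<in>{0}. \<beta> j * x)"
      unfolding shift_op_geometric by (rule sum.mono_neutral_cong_right) auto
    then show ?thesis by simp
  qed
  define g where "g t = deriv_on {-\<tau>..} (n - 1) ?y t + \<nu> * deriv_on {-\<tau>..} (n - 1) ?y (t - \<tau>)" for t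
  define c where "c = s0 ^ p * (1 + \<nu> * exp (- (s0 * \<tau>)))"
  have g: "g t = c * exp (s0 * t)" if "t \<ge> 0" for t
  proof -
    have "g t = s0 ^ p * exp (s0 * t) + \<nu> * (s0 ^ p * exp (s0 * (t - \<tau>)))"
      using that \<tau> by (simp add: g_def D n)
    then show ?thesis by (simp only: e) (simp add: c_def algebra_simps)
  qed
  have "deriv_on {0..} 1 g t + (\<Sum>k<n. a k * deriv_on {-\<tau>..} k ?y t) +
      (\<Sum>k | k \<le> m \<and> k < n. \<alpha> k * deriv_on {-\<tau>..} k ?y (t - \<tau>)) = 0" if "t \<ge> 0" for t
  proof -
    let ?x = "exp (s0 * t)" and ?x' = "exp (s0 * (t - \<tau>))"
    have "deriv_on {0..} 1 g t = ?x * s0 ^ n + \<nu> * (?x' * s0 ^ n)"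
    proof -
      have "deriv_on {0..} 1 g t = c * s0 * ?x" using deriv_on_exponential[OF g that, of 1] by simp
      then show ?thesis by (simp only: e) (simp add: c_def n algebra_simps)
    qed
    moreover have "(\<Sum>k<n. a k * deriv_on {-\<tau>..} k ?y t) = (\<Sum>k<n. a k * (?x * s0 ^ k))"
      by (rule sum.cong) (use that \<tau> in \<open>auto simp: D\<close>)
    moreover have "(\<Sum>k | k \<le> m \<and> k < n. \<alpha> k * deriv_on {-\<tau>..} k ?y (t - \<tau>)) =
        (\<Sum>k | k \<le> m \<and> k < n. \<alpha> k * (?x' * s0 ^ k))"
      by (rule sum.cong) (use that \<tau> in \<open>auto simp: D\<close>)
    moreover have "(\<Sum>k<n. a k * (?x * s0 ^ k)) + ?x * s0 ^ n = pade_coeff n m \<tau> 0 * ?x"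
      using undelayed_shift[of "\<lambda>k. ?x * s0 ^ k"] by (simp only: delta)
    moreover have "(\<Sum>k | k \<le> m \<and> k < n. \<alpha> k * (?x' * s0 ^ k)) + \<nu> * (?x' * s0 ^ n) =
        exp (s0 * \<tau>) * (pade_delay_coeff n m \<tau> 0 * ?x')"
      using delayed_shift[of "\<lambda>k. ?x' * s0 ^ k"] by (simp only: delta)
    moreover have "exp (s0 * \<tau>) * (pade_delay_coeff n m \<tau> 0 * ?x') = pade_delay_coeff n m \<tau> 0 * ?x"
      by (simp add: e exp_minus)
    moreover have "pade_coeff n m \<tau> 0 * ?x + pade_delay_coeff n m \<tau> 0 * ?x = 0"
      using pade_coeff_0_sum[of n m \<tau>] by (simp flip: distrib_right)
    ultimately show ?thesis by linarith
  qed
  moreover have "class_C_on (n - 1) {-\<tau>..} ?y"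
    by (rule class_C_on_exponential[where c = 1 and d = s0]) simp
  moreover have "class_C_on 1 {0..} g" by (rule class_C_on_exponential[OF g])
  ultimately show ?thesis unfolding dde_solution_def Let_def g_def by blast
qed

lemma not_stable_if_nonneg:
  assumes "s0 \<ge> 0"
  shows "\<not> dde_exp_stable n m \<tau> a \<alpha>"
proof
  let ?y = "\<lambda>t. exp (s0 * t)"
  assume "dde_exp_stable n m \<tau> a \<alpha>"
  then obtain C \<omega> where "C > 0" "\<omega> > 0" and st: "\<And>t. t \<ge> 0 \<Longrightarrow>
      (MAX j\<in>{0..n - 1}. \<bar>deriv_on {-\<tau>..} j ?y t\<bar>) \<le> C * exp (- \<omega> * t) *
        (MAX j\<in>{0..n - 1}. SUP \<theta>\<in>{-\<tau>..0}. \<bar>deriv_on {-\<tau>..} j ?y \<theta>\<bar>)"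
    using exponential_solution unfolding dde_exp_stable_def by blast
  define D where "D = C * (MAX j\<in>{0..n - 1}. SUP \<theta>\<in>{-\<tau>..0}. \<bar>deriv_on {-\<tau>..} j ?y \<theta>\<bar>)"
  have D: "1 \<le> D * exp (- \<omega> * t)" if "t \<ge> 0" for t
  proof -
    have "1 \<le> \<bar>deriv_on {-\<tau>..} 0 ?y t\<bar>" using that assms by simp
    also have "\<dots> \<le> (MAX j\<in>{0..n - 1}. \<bar>deriv_on {-\<tau>..} j ?y t\<bar>)"
      by (rule Max_ge) (auto intro: image_eqI[where x = 0])
    also have "\<dots> \<le> D * exp (- \<omega> * t)" using st[OF that] by (simp add: D_def mult_ac)
    finally show ?thesis .
  qed
  have "D \<ge> 1" using D[of 0] by simp
  then have "1 \<le> D * exp (- ln (2 * D))"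
    using D[of "ln (2 * D) / \<omega>"] \<open>\<omega> > 0\<close> by simp
  with \<open>D \<ge> 1\<close> show False by (simp add: exp_minus field_simps)
qed

end

section \<open>Stability for negative s0\<close>

context mid_equation
begin

lemma solution_has_derivative:
  assumes "dde_solution n m \<tau> a \<alpha> y"
  shows "k < p \<Longrightarrow> s \<ge> -\<tau> \<Longrightarrow>
      (deriv_on {-\<tau>..} k y has_real_derivative deriv_on {-\<tau>..} (Suc k) y s) (at s within {-\<tau>..})"
    and "continuous_on {-\<tau>..} (deriv_on {-\<tau>..} p y)"
    and "t \<ge> 0 \<Longrightarrow>
      ((\<lambda>t. deriv_on {-\<tau>..} p y t + \<nu> * deriv_on {-\<tau>..} p y (t - \<tau>)) has_real_derivative
        - ((\<Sum>k<n. a k * deriv_on {-\<tau>..} k y t) +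
           (\<Sum>k | k \<le> m \<and> k < n. \<alpha> k * deriv_on {-\<tau>..} k y (t - \<tau>)))) (at t within {0..})"
proof -
  let ?g = "\<lambda>t. deriv_on {-\<tau>..} p y t + \<nu> * deriv_on {-\<tau>..} p y (t - \<tau>)"
  from assms have y: "class_C_on p {-\<tau>..} y" and g: "class_C_on 1 {0..} ?g"
    and eq: "\<And>t. t \<ge> 0 \<Longrightarrow> deriv_on {0..} 1 ?g t + (\<Sum>k<n. a k * deriv_on {-\<tau>..} k y t) +
      (\<Sum>k | k \<le> m \<and> k < n. \<alpha> k * deriv_on {-\<tau>..} k y (t - \<tau>)) = 0"
    by (simp_all add: dde_solution_def Let_def n)
  show "continuous_on {-\<tau>..} (deriv_on {-\<tau>..} p y)" using y by (simp add: class_C_on_def)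
  show "(deriv_on {-\<tau>..} k y has_real_derivative deriv_on {-\<tau>..} (Suc k) y s) (at s within {-\<tau>..})"
    if "k < p" "s \<ge> -\<tau>"
    using y that
    by (simp add: class_C_on_def differentiable_on_def has_real_derivative_iff_has_vector_derivative
        vector_derivative_works)
  show "(?g has_real_derivative
        - ((\<Sum>k<n. a k * deriv_on {-\<tau>..} k y t) +
           (\<Sum>k | k \<le> m \<and> k < n. \<alpha> k * deriv_on {-\<tau>..} k y (t - \<tau>)))) (at t within {0..})"
    if "t \<ge> 0"
  proof -
    have "?g differentiable (at t within {0..})"
      using g that by (simp add: class_C_on_def differentiable_on_def)
    then have "(?g has_real_derivative deriv_on {0..} 1 ?g t) (at t within {0..})"
      by (simp add: has_real_derivative_iff_has_vector_derivative vector_derivative_works)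
    moreover have "deriv_on {0..} 1 ?g t = - ((\<Sum>k<n. a k * deriv_on {-\<tau>..} k y t) +
           (\<Sum>k | k \<le> m \<and> k < n. \<alpha> k * deriv_on {-\<tau>..} k y (t - \<tau>)))"
      using eq[OF that] by linarith
    ultimately show ?thesis by metis
  qed
qed

lemma solution_continuous:
  assumes y: "dde_solution n m \<tau> a \<alpha> y" and "k \<le> p"
  shows "continuous_on {-\<tau>..} (deriv_on {-\<tau>..} k y)"
proof (cases "k = p")
  case True
  then show ?thesis using solution_has_derivative(2)[OF y] by simp
next
  case False
  then show ?thesis using solution_has_derivative(1)[OF y, of k] \<open>k \<le> p\<close>
    unfolding continuous_on_eq_continuous_within by (metis DERIV_continuous atLeast_iff le_neq_implies_less)
qed

text \<open>
  The \<open>k\<close>-th derivative of \<open>exp (- s0 t) * y t\<close>.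
\<close>

definition detrended :: "(real \<Rightarrow> real) \<Rightarrow> nat \<Rightarrow> real \<Rightarrow> real" where
  "detrended y k t = exp (- (s0 * t)) * shift_op s0 k (\<lambda>i. deriv_on {-\<tau>..} i y t)"

lemma detrended_has_derivative:
  assumes y: "dde_solution n m \<tau> a \<alpha> y" and "k < p" "s \<ge> -\<tau>"
  shows "(detrended y k has_real_derivative detrended y (Suc k) s) (at s within {-\<tau>..})"
proof -
  have "((\<lambda>t. shift_op s0 k (\<lambda>i. deriv_on {-\<tau>..} i y t)) has_real_derivative
      shift_op s0 k (\<lambda>i. deriv_on {-\<tau>..} (Suc i) y s)) (at s within {-\<tau>..})"
    using assms by (intro shift_op_has_derivative solution_has_derivative(1)[OF y]) auto
  moreover have "((\<lambda>t. exp (- (s0 * t))) has_real_derivative - s0 * exp (- (s0 * s))) (at s within {-\<tau>..})"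
    by (auto intro!: derivative_eq_intros)
  ultimately have "((\<lambda>t. exp (- (s0 * t)) * shift_op s0 k (\<lambda>i. deriv_on {-\<tau>..} i y t)) has_real_derivative
     - s0 * exp (- (s0 * s)) * shift_op s0 k (\<lambda>i. deriv_on {-\<tau>..} i y s) +
     shift_op s0 k (\<lambda>i. deriv_on {-\<tau>..} (Suc i) y s) * exp (- (s0 * s))) (at s within {-\<tau>..})"
    by (rule DERIV_mult[rotated])
  then show ?thesis unfolding detrended_def by (simp only: shift_op.simps) (simp only: algebra_simps mult_minus_left add_uminus_conv_diff)
qed

lemma detrended_continuous:
  assumes y: "dde_solution n m \<tau> a \<alpha> y" and "k \<le> p"
  shows "continuous_on {-\<tau>..} (detrended y k)"
proof -
  show ?thesis
    unfolding detrended_def using assms(2)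
    by (intro continuous_intros continuous_on_shift_op solution_continuous[OF y]) auto
qed

text \<open>
  The detrended solution satisfies the equation for \<open>s0 = 0\<close>. At a fixed time, \<open>b\<close> and \<open>d\<close> collect the
  undelayed and the delayed derivatives of \<open>y\<close>. Since only the combination of order \<open>n\<close> of both is
  meaningful, its value \<open>X\<close> is booked entirely under \<open>b\<close>.
\<close>

lemma detrended_equation:
  assumes y: "dde_solution n m \<tau> a \<alpha> y" and t: "t \<ge> 0"
  shows "((\<lambda>t. detrended y p t + pade_delay_coeff n m \<tau> n * detrended y p (t - \<tau>)) has_real_derivative
    - (\<Sum>k<n. pade_coeff n m \<tau> k * detrended y k t + pade_delay_coeff n m \<tau> k * detrended y k (t - \<tau>)))
    (at t within {0..})"
proof -
  let ?Y = "\<lambda>k. deriv_on {-\<tau>..} k y"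
  define X where "X = - ((\<Sum>k<n. a k * ?Y k t) + (\<Sum>k | k \<le> m \<and> k < n. \<alpha> k * ?Y k (t - \<tau>)))"
  define b where "b i = (if i < n then ?Y i t else X)" for i
  define d where "d i = (if i < n then ?Y i (t - \<tau>) else 0)" for i
  have e: "exp (- (s0 * (s - \<tau>))) = exp (s0 * \<tau>) * exp (- (s0 * s))" for s
    by (simp add: algebra_simps flip: exp_add)
  have g: "detrended y p s + pade_delay_coeff n m \<tau> n * detrended y p (s - \<tau>) =
      exp (- (s0 * s)) * shift_op s0 p (\<lambda>i. ?Y i s + \<nu> * ?Y i (s - \<tau>))" for s
    unfolding detrended_def shift_op_add shift_op_mult neutral_coeff_eq e by (simp add: algebra_simps)
  have der_i: "((\<lambda>t. ?Y i t + \<nu> * ?Y i (t - \<tau>)) has_real_derivative b (Suc i) + \<nu> * d (Suc i)) (at t within {0..})"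
    if "i \<le> p" for i
  proof (cases "i = p")
    case True
    then show ?thesis
      using solution_has_derivative(3)[OF y t] by (simp add: b_def d_def n X_def)
  next
    case False
    with that have i: "i < p" by simp
    have 1: "(?Y i has_real_derivative ?Y (Suc i) t) (at t within {0..})"
      by (rule DERIV_subset[OF solution_has_derivative(1)[OF y i]]) (use t \<tau> in auto)
    have "(?Y i has_real_derivative ?Y (Suc i) (t - \<tau>)) (at (t - \<tau>) within (\<lambda>t. t - \<tau>) ` {0..})"
      by (rule DERIV_subset[OF solution_has_derivative(1)[OF y i]]) (use t \<tau> in auto)
    moreover have "((\<lambda>t. t - \<tau>) has_real_derivative 1) (at t within {0..})"
      by (auto intro!: derivative_eq_intros)
    ultimately have "((\<lambda>t. ?Y i (t - \<tau>)) has_real_derivative ?Y (Suc i) (t - \<tau>)) (at t within {0..})"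
      using DERIV_image_chain[of "?Y i" "?Y (Suc i) (t - \<tau>)" "\<lambda>t. t - \<tau>" t "{0..}" 1]
      by (simp only: o_def mult_1_right)
    with 1 have "((\<lambda>t. ?Y i t + \<nu> * ?Y i (t - \<tau>)) has_real_derivative ?Y (Suc i) t + \<nu> * ?Y (Suc i) (t - \<tau>)) (at t within {0..})"
      by (intro DERIV_add DERIV_cmult)
    moreover have "b (Suc i) = ?Y (Suc i) t" "d (Suc i) = ?Y (Suc i) (t - \<tau>)"
      using i by (simp_all only: b_def d_def n) simp_all
    ultimately show ?thesis by simp
  qed
  have "((\<lambda>t. shift_op s0 p (\<lambda>i. ?Y i t + \<nu> * ?Y i (t - \<tau>))) has_real_derivative
      shift_op s0 p (\<lambda>i. b (Suc i) + \<nu> * d (Suc i))) (at t within {0..})"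
    by (rule shift_op_has_derivative) (rule der_i)
  moreover have "((\<lambda>t. exp (- (s0 * t))) has_real_derivative - s0 * exp (- (s0 * t))) (at t within {0..})"
    by (auto intro!: derivative_eq_intros)
  ultimately have "((\<lambda>t. exp (- (s0 * t)) * shift_op s0 p (\<lambda>i. ?Y i t + \<nu> * ?Y i (t - \<tau>))) has_real_derivative
      - s0 * exp (- (s0 * t)) * shift_op s0 p (\<lambda>i. ?Y i t + \<nu> * ?Y i (t - \<tau>)) +
      shift_op s0 p (\<lambda>i. b (Suc i) + \<nu> * d (Suc i)) * exp (- (s0 * t))) (at t within {0..})"
    by (rule DERIV_mult[rotated])
  moreover have "shift_op s0 p (\<lambda>i. ?Y i t + \<nu> * ?Y i (t - \<tau>)) = shift_op s0 p (\<lambda>i. b i + \<nu> * d i)"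
    by (rule shift_op_cong) (simp add: b_def d_def n)
  moreover have "- s0 * exp (- (s0 * t)) * shift_op s0 p (\<lambda>i. b i + \<nu> * d i) +
      shift_op s0 p (\<lambda>i. b (Suc i) + \<nu> * d (Suc i)) * exp (- (s0 * t)) =
      exp (- (s0 * t)) * (shift_op s0 n b + \<nu> * shift_op s0 n d)"
    by (simp only: n shift_op.simps shift_op_add shift_op_mult) (simp add: algebra_simps)
  moreover have "exp (- (s0 * t)) * (shift_op s0 n b + \<nu> * shift_op s0 n d) =
      - (\<Sum>k<n. pade_coeff n m \<tau> k * detrended y k t + pade_delay_coeff n m \<tau> k * detrended y k (t - \<tau>))"
  proof -
    have Z: "detrended y k t = exp (- (s0 * t)) * shift_op s0 k b"
      "detrended y k (t - \<tau>) = exp (- (s0 * t)) * (exp (s0 * \<tau>) * shift_op s0 k d)" if "k < n" for k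
    proof -
      have "shift_op s0 k (\<lambda>i. ?Y i t) = shift_op s0 k b" "shift_op s0 k (\<lambda>i. ?Y i (t - \<tau>)) = shift_op s0 k d"
        by (rule shift_op_cong; use that in \<open>simp add: b_def d_def\<close>)+
      then show "detrended y k t = exp (- (s0 * t)) * shift_op s0 k b"
        "detrended y k (t - \<tau>) = exp (- (s0 * t)) * (exp (s0 * \<tau>) * shift_op s0 k d)"
        unfolding detrended_def e by simp_all
    qed
    have sum_eq: "(\<Sum>k<n. pade_coeff n m \<tau> k * detrended y k t + pade_delay_coeff n m \<tau> k * detrended y k (t - \<tau>)) =
       exp (- (s0 * t)) * ((\<Sum>k<n. pade_coeff n m \<tau> k * shift_op s0 k b) +
         exp (s0 * \<tau>) * (\<Sum>k<n. pade_delay_coeff n m \<tau> k * shift_op s0 k d))"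
      unfolding sum_distrib_left sum.distrib[symmetric]
      by (rule sum.cong) (simp_all add: Z algebra_simps)
    have "(\<Sum>k<n. pade_coeff n m \<tau> k * shift_op s0 k b) + shift_op s0 n b = (\<Sum>k<n. a k * b k) + b n"
      using undelayed_shift[of b] \<tau> unfolding lessThan_Suc_atMost[symmetric] by (simp add: pade_coeff_top)
    moreover have "exp (s0 * \<tau>) * (\<Sum>k<n. pade_delay_coeff n m \<tau> k * shift_op s0 k d) + \<nu> * shift_op s0 n d =
        (\<Sum>k | k \<le> m \<and> k < n. \<alpha> k * d k) + \<nu> * d n"
      using delayed_shift[of d] unfolding lessThan_Suc_atMost[symmetric] neutral_coeff_eq
      by (simp add: algebra_simps)
    moreover have "(\<Sum>k<n. a k * b k) + b n + ((\<Sum>k | k \<le> m \<and> k < n. \<alpha> k * d k) + \<nu> * d n) = 0"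
      by (simp add: b_def d_def X_def)
    ultimately have "shift_op s0 n b + \<nu> * shift_op s0 n d =
        - ((\<Sum>k<n. pade_coeff n m \<tau> k * shift_op s0 k b) +
         exp (s0 * \<tau>) * (\<Sum>k<n. pade_delay_coeff n m \<tau> k * shift_op s0 k d))" by linarith
    then show ?thesis unfolding sum_eq by (simp only: mult_minus_right)
  qed
  ultimately show ?thesis unfolding g by simp
qed

lemma detrended_first_integral:
  assumes y: "dde_solution n m \<tau> a \<alpha> y"
  shows "\<exists>c. \<forall>t\<ge>0. poly ((pderiv ^^ m) (pade_kernel n m \<tau>)) 0 * detrended y p t -
    poly ((pderiv ^^ m) (pade_kernel n m \<tau>)) \<tau> * detrended y p (t - \<tau>) +
    wint \<tau> (detrended y p) t ((pderiv ^^ Suc m) (pade_kernel n m \<tau>)) = c"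
proof (rule pade_kernel_first_integral[OF \<tau> n detrended_has_derivative[OF y] detrended_continuous[OF y order_refl]])
  fix t :: real assume t: "t \<ge> 0"
  let ?K = "\<lambda>i. (pderiv ^^ i) (pade_kernel n m \<tau>)"
  define k0 where "k0 = fact m * \<tau> ^ n"
  have k0: "k0 \<noteq> 0" using \<tau> by (simp add: k0_def)
  have 1: "poly (?K (n + m - k)) 0 = k0 * pade_coeff n m \<tau> k" "poly (?K (n + m - k)) \<tau> = - k0 * pade_delay_coeff n m \<tau> k" for k
    using k0 by (simp_all add: pade_coeff_def pade_delay_coeff_def flip: k0_def)
  have 2: "poly (?K m) 0 = k0" "poly (?K m) \<tau> = - k0 * pade_delay_coeff n m \<tau> n"
    using 1[of n] \<tau> by (simp_all add: pade_coeff_top)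
  have "((\<lambda>t. k0 * (detrended y p t + pade_delay_coeff n m \<tau> n * detrended y p (t - \<tau>))) has_real_derivative
    k0 * - (\<Sum>k<n. pade_coeff n m \<tau> k * detrended y k t + pade_delay_coeff n m \<tau> k * detrended y k (t - \<tau>)))
    (at t within {0..})"
    by (rule DERIV_cmult[OF detrended_equation[OF y t]])
  then show "((\<lambda>t. poly (?K m) 0 * detrended y p t - poly (?K m) \<tau> * detrended y p (t - \<tau>)) has_real_derivative
        - (\<Sum>k<n. poly (?K (n + m - k)) 0 * detrended y k t - poly (?K (n + m - k)) \<tau> * detrended y k (t - \<tau>))) (at t within {0..})"
    unfolding 1 2 by (simp add: sum_distrib_left algebra_simps)
qed

text \<open>
  The bound for the detrended derivative of order \<open>p = n - 1\<close> comes from the window equation; lower orders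
  follow by successive integration, each of which costs a factor \<open>1 / \<epsilon>\<close> and an initial value.
  Finally \<open>shift_op (- s0)\<close> recovers the derivatives of \<open>y\<close>.
\<close>

lemma solution_growth:
  assumes \<epsilon>: "\<epsilon> > 0"
  shows "\<exists>C>0. \<forall>y B. dde_solution n m \<tau> a \<alpha> y \<longrightarrow> B > 0 \<longrightarrow>
    (\<forall>j\<le>p. \<forall>\<theta>\<in>{-\<tau>..0}. \<bar>deriv_on {-\<tau>..} j y \<theta>\<bar> \<le> B) \<longrightarrow>
    (\<forall>t\<ge>0. \<forall>j\<le>p. \<bar>deriv_on {-\<tau>..} j y t\<bar> \<le> C * B * exp ((s0 + \<epsilon>) * t))"
proof -
  let ?K = "\<lambda>i. (pderiv ^^ i) (pade_kernel n m \<tau>)"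
  obtain C0 where C0: "C0 > 0" and growth: "\<forall>w B c. continuous_on {-\<tau>..} w \<longrightarrow> B > 0 \<longrightarrow> (\<forall>s\<in>{-\<tau>..0}. \<bar>w s\<bar> \<le> B) \<longrightarrow>
    (\<forall>t\<ge>0. poly (?K m) 0 * w t - poly (?K m) \<tau> * w (t - \<tau>) + wint \<tau> w t (?K (Suc m)) = c) \<longrightarrow>
    (\<forall>t\<ge>-\<tau>. \<bar>w t\<bar> \<le> C0 * B * exp (\<epsilon> * t))"
    using pade_kernel_growth[OF \<tau> mn \<epsilon>] by (elim exE conjE) (rule that)
  define S where "S = (1 + \<bar>s0\<bar>) ^ p"
  have S: "S > 0" unfolding S_def by (intro zero_less_power) (simp add: add_pos_nonneg)
  have S_le: "(1 + \<bar>s0\<bar>) ^ j \<le> S" if "j \<le> p" for j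
    unfolding S_def by (intro power_increasing that) simp
  define E where "E = exp (\<bar>s0\<bar> * \<tau>) * S"
  have E: "E > 0" using S by (simp add: E_def)
  define c where "c = rec_nat (C0 * E) (\<lambda>_ x. E + x / \<epsilon>)"
  have c_simps: "c 0 = C0 * E" "c (Suc i) = E + c i / \<epsilon>" for i by (simp_all add: c_def)
  have c_pos: "c i > 0" for i
    using C0 E \<epsilon> by (induction i) (auto simp: c_simps intro!: add_pos_pos)
  define C where "C = S * (\<Sum>i\<le>p. c i)"
  have "C > 0" unfolding C_def using S c_pos by (intro mult_pos_pos sum_pos) auto
  show ?thesis
  proof (intro exI[of _ C] conjI allI impI)
    show "C > 0" by fact
    fix y :: "real \<Rightarrow> real" and B t :: real and j :: nat
    assume y: "dde_solution n m \<tau> a \<alpha> y" and B: "B > 0"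
      and init: "\<forall>j\<le>p. \<forall>\<theta>\<in>{-\<tau>..0}. \<bar>deriv_on {-\<tau>..} j y \<theta>\<bar> \<le> B"
      and t: "0 \<le> t" and j: "j \<le> p"
    have initZ: "\<bar>detrended y k \<theta>\<bar> \<le> E * B" if "k \<le> p" "\<theta> \<in> {-\<tau>..0}" for k \<theta>
    proof -
      have "\<bar>shift_op s0 k (\<lambda>i. deriv_on {-\<tau>..} i y \<theta>)\<bar> \<le> (1 + \<bar>s0\<bar>) ^ k * B"
        using init that by (intro shift_op_bound) auto
      also have "\<dots> \<le> S * B" using B S_le[OF \<open>k \<le> p\<close>] by (intro mult_right_mono) auto
      finally have 1: "\<bar>shift_op s0 k (\<lambda>i. deriv_on {-\<tau>..} i y \<theta>)\<bar> \<le> S * B" .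
      have "- (s0 * \<theta>) \<le> \<bar>s0\<bar> * \<bar>\<theta>\<bar>" by (simp flip: abs_mult)
      also have "\<dots> \<le> \<bar>s0\<bar> * \<tau>" using that by (intro mult_left_mono) auto
      finally have "exp (- (s0 * \<theta>)) \<le> exp (\<bar>s0\<bar> * \<tau>)" by simp
      then have "exp (- (s0 * \<theta>)) * \<bar>shift_op s0 k (\<lambda>i. deriv_on {-\<tau>..} i y \<theta>)\<bar> \<le> exp (\<bar>s0\<bar> * \<tau>) * (S * B)"
        using 1 by (intro mult_mono) auto
      then show ?thesis by (simp add: detrended_def abs_mult E_def)
    qed
    have Z: "i \<le> p \<Longrightarrow> t \<ge> 0 \<Longrightarrow> \<bar>detrended y (p - i) t\<bar> \<le> c i * B * exp (\<epsilon> * t)" for i t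
    proof (induction i arbitrary: t)
      case 0
      obtain d where "\<forall>t\<ge>0. poly (?K m) 0 * detrended y p t - poly (?K m) \<tau> * detrended y p (t - \<tau>) +
          wint \<tau> (detrended y p) t (?K (Suc m)) = d"
        using detrended_first_integral[OF y] by blast
      then have "\<bar>detrended y p t\<bar> \<le> C0 * (E * B) * exp (\<epsilon> * t)"
        using initZ[OF order_refl] E B \<tau> 0
        by (intro growth[rule_format, where c = d] detrended_continuous[OF y]) auto
      then show ?case by (simp add: c_simps mult.assoc)
    next
      case (Suc i)
      then have i: "p - Suc i < p" "Suc (p - Suc i) = p - i" by auto
      have "\<bar>detrended y (p - Suc i) t\<bar> \<le> (\<bar>detrended y (p - Suc i) 0\<bar> + c i * B / \<epsilon>) * exp (\<epsilon> * t)"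
      proof (rule derivative_exponential_growth[OF \<epsilon> \<open>t \<ge> 0\<close>])
        fix s :: real assume s: "s \<ge> 0"
        have "(detrended y (p - Suc i) has_real_derivative detrended y (p - i) s) (at s within {-\<tau>..})"
          using detrended_has_derivative[OF y i(1), of s] s \<tau> unfolding i(2) by simp
        moreover have "at s within {-\<tau>..} = at s"
          using s \<tau> by (intro at_within_interior) simp
        ultimately show "(detrended y (p - Suc i) has_real_derivative detrended y (p - i) s) (at s)" by simp
        show "\<bar>detrended y (p - i) s\<bar> \<le> c i * B * exp (\<epsilon> * s)" using Suc s by simp
      qed
      also have "\<dots> \<le> (E * B + c i * B / \<epsilon>) * exp (\<epsilon> * t)"
        using initZ[of "p - Suc i" 0] \<tau> by (intro mult_right_mono add_mono) auto
      finally show ?case by (simp add: c_simps algebra_simps)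
    qed
    define M where "M = (\<Sum>i\<le>p. c i) * B * exp (\<epsilon> * t)"
    have Mk: "\<bar>detrended y k t\<bar> \<le> M" if "k \<le> p" for k
    proof -
      have "\<bar>detrended y (p - (p - k)) t\<bar> \<le> c (p - k) * B * exp (\<epsilon> * t)" using t by (intro Z) auto
      also have "\<dots> \<le> M"
        unfolding M_def using B c_pos by (intro mult_right_mono member_le_sum) (auto intro: less_imp_le)
      finally show ?thesis using that by simp
    qed
    have "M \<ge> 0" using Mk[of 0] by simp
    have "\<bar>exp (s0 * t) * detrended y k t\<bar> \<le> exp (s0 * t) * M" if "k \<le> p" for k
      using Mk[OF that] by (simp add: abs_mult)
    moreover have "exp (s0 * t) * detrended y k t = shift_op s0 k (\<lambda>i. deriv_on {-\<tau>..} i y t)" for k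
      by (simp add: detrended_def mult.assoc[symmetric] flip: exp_add)
    ultimately have "\<bar>shift_op (- s0) j (\<lambda>k. shift_op s0 k (\<lambda>i. deriv_on {-\<tau>..} i y t))\<bar> \<le> (1 + \<bar>- s0\<bar>) ^ j * (exp (s0 * t) * M)"
      using j by (intro shift_op_bound) auto
    also have "\<dots> \<le> S * (exp (s0 * t) * M)"
      using S_le[OF j] \<open>M \<ge> 0\<close> by (intro mult_right_mono) auto
    also have "\<dots> = C * B * exp ((s0 + \<epsilon>) * t)"
      by (simp add: C_def M_def distrib_right exp_add)
    finally show "\<bar>deriv_on {-\<tau>..} j y t\<bar> \<le> C * B * exp ((s0 + \<epsilon>) * t)"
      by (simp add: shift_op_inverse)
  qed
qed

lemma stable_if_neg:
  assumes "s0 < 0"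
  shows "dde_exp_stable n m \<tau> a \<alpha>"
proof -
  have pos: "- s0 / 2 > 0" using assms by simp
  obtain C where C: "C > 0" and growth: "\<forall>y B. dde_solution n m \<tau> a \<alpha> y \<longrightarrow> B > 0 \<longrightarrow>
    (\<forall>j\<le>p. \<forall>\<theta>\<in>{-\<tau>..0}. \<bar>deriv_on {-\<tau>..} j y \<theta>\<bar> \<le> B) \<longrightarrow>
    (\<forall>t\<ge>0. \<forall>j\<le>p. \<bar>deriv_on {-\<tau>..} j y t\<bar> \<le> C * B * exp ((s0 + - s0 / 2) * t))"
    using solution_growth[OF pos] by (elim exE conjE) (rule that)
  have "(MAX j\<in>{0..n - 1}. \<bar>deriv_on {-\<tau>..} j y t\<bar>)
           \<le> C * exp (- (- s0 / 2) * t) *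
              (MAX j\<in>{0..n - 1}. SUP \<theta>\<in>{-\<tau>..0}. \<bar>deriv_on {-\<tau>..} j y \<theta>\<bar>)"
    if y: "dde_solution n m \<tau> a \<alpha> y" and t: "t \<ge> 0" for y t
  proof -
    define N where "N = (MAX j\<in>{0..n - 1}. SUP \<theta>\<in>{-\<tau>..0}. \<bar>deriv_on {-\<tau>..} j y \<theta>\<bar>)"
    have N: "\<bar>deriv_on {-\<tau>..} j y \<theta>\<bar> \<le> N" if "j \<le> p" "\<theta> \<in> {-\<tau>..0}" for j \<theta>
    proof -
      have "continuous_on {-\<tau>..} (deriv_on {-\<tau>..} j y)"
        by (rule solution_continuous[OF y that(1)])
      then have "continuous_on {-\<tau>..0} (\<lambda>\<theta>. \<bar>deriv_on {-\<tau>..} j y \<theta>\<bar>)"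
        by (intro continuous_intros) (rule continuous_on_subset, auto)
      then have "compact ((\<lambda>\<theta>. \<bar>deriv_on {-\<tau>..} j y \<theta>\<bar>) ` {-\<tau>..0})"
        by (intro compact_continuous_image compact_Icc)
      then have "bdd_above ((\<lambda>\<theta>. \<bar>deriv_on {-\<tau>..} j y \<theta>\<bar>) ` {-\<tau>..0})"
        by (intro bounded_imp_bdd_above compact_imp_bounded)
      then have "\<bar>deriv_on {-\<tau>..} j y \<theta>\<bar> \<le> (SUP \<theta>\<in>{-\<tau>..0}. \<bar>deriv_on {-\<tau>..} j y \<theta>\<bar>)"
        using that by (intro cSUP_upper)
      also have "\<dots> \<le> N" unfolding N_def using that n by (intro Max_ge) auto
      finally show ?thesis .
    qed
    define x where "x = exp (- (- s0 / 2) * t)"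
    have N0: "N \<ge> 0" using N[of 0 0] \<tau> by (auto intro: order_trans[OF abs_ge_zero])
    have "\<bar>deriv_on {-\<tau>..} j y t\<bar> \<le> C * x * N" if "j \<le> p" for j
    \<comment> \<open>the growth bound needs a positive size of the initial data, whereas \<open>N\<close> may be zero\<close>
    proof (rule field_le_epsilon)
      fix e :: real assume "e > 0"
      define \<eta> where "\<eta> = e / (C * x)"
      have "C * x > 0" using C by (simp add: x_def)
      then have "\<eta> > 0" using \<open>e > 0\<close> by (simp add: \<eta>_def)
      have "\<bar>deriv_on {-\<tau>..} j y t\<bar> \<le> C * (N + \<eta>) * exp ((s0 + - s0 / 2) * t)"
      proof (rule growth[rule_format, OF y _ _ t that])
        show "N + \<eta> > 0" using N0 \<open>\<eta> > 0\<close> by simp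
        fix j \<theta> assume "j \<le> p" "\<theta> \<in> {-\<tau>..0}"
        then show "\<bar>deriv_on {-\<tau>..} j y \<theta>\<bar> \<le> N + \<eta>" using N[of j \<theta>] \<open>\<eta> > 0\<close> by simp
      qed
      also have "(s0 + - s0 / 2) * t = - (- s0 / 2) * t" by (simp add: field_simps)
      also have "C * (N + \<eta>) * exp (- (- s0 / 2) * t) = C * x * N + C * x * \<eta>"
        unfolding x_def[symmetric] by (simp add: algebra_simps)
      also have "C * x * \<eta> = e" using \<open>C * x > 0\<close> unfolding \<eta>_def by (metis nonzero_mult_div_cancel_left less_irrefl times_divide_eq_right)
      finally show "\<bar>deriv_on {-\<tau>..} j y t\<bar> \<le> C * x * N + e" .
    qed
    then show ?thesis
      unfolding N_def[symmetric] x_def[symmetric] using n by (intro Max.boundedI) auto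
  qed
  then show ?thesis
    unfolding dde_exp_stable_def using C assms
    by (intro exI[of _ C] exI[of _ "- s0 / 2"] conjI allI impI) auto
qed

end

section \<open>The stability criterion\<close>

theorem theorem3p10:
  fixes n m :: nat and \<tau> s0 :: real and a \<alpha> :: "nat \<Rightarrow> real"
  assumes "n > 0" and "m \<le> n" and "\<tau> > 0"
    and "\<And>k. k \<le> n - 1 \<Longrightarrow>
      a k = real (n choose k) * (- s0) ^ (n - k)
        + (- 1) ^ (n - k) * fact n *
          (\<Sum>j = k..n - 1. real (j choose k) * real ((m + n - j) choose m) * s0 ^ (j - k)
             / (fact j * \<tau> ^ (n - j)))"
    and "\<And>k. k \<le> m \<Longrightarrow>
      \<alpha> k = (- 1) ^ (n - 1) * exp (s0 * \<tau>) *
          (\<Sum>j = k..m. (- 1) ^ (j - k) * fact (m + n - j) * s0 ^ (j - k)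
             / (fact k * fact (j - k) * fact (m - j) * \<tau> ^ (n - j)))"
  shows "dde_exp_stable n m \<tau> a \<alpha> \<longleftrightarrow> a (n - 1) > - (real n * (real m + 1) / \<tau>)"
proof -
  obtain p where n: "n = Suc p" using \<open>n > 0\<close> gr0_implies_Suc by blast
  have minus_power: "(- s0) ^ i = (- 1) ^ i * s0 ^ i" for i
    by (metis mult_minus1 power_mult_distrib)
  have mid: "mid_equation n m p \<tau> s0 a \<alpha>"
  proof
    fix k assume k: "k < n"
    have sign: "(- 1) ^ (j - k) * (- 1) ^ (n - j) = ((- 1) ^ (n - k) :: real)" if "k \<le> j" "j \<le> n" for j
      using that by (simp flip: power_add)
    have "(\<Sum>j=k..n. real (j choose k) * (- s0) ^ (j - k) * pade_coeff n m \<tau> j) =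
       real (n choose k) * (- s0) ^ (n - k) + (\<Sum>j=k..n - 1. real (j choose k) * (- s0) ^ (j - k) * pade_coeff n m \<tau> j)"
      using k \<open>\<tau> > 0\<close> by (simp add: n sum.cl_ivl_Suc pade_coeff_top)
    also have "(\<Sum>j=k..n - 1. real (j choose k) * (- s0) ^ (j - k) * pade_coeff n m \<tau> j) =
       (- 1) ^ (n - k) * fact n *
          (\<Sum>j = k..n - 1. real (j choose k) * real ((m + n - j) choose m) * s0 ^ (j - k)
             / (fact j * \<tau> ^ (n - j)))"
      unfolding sum_distrib_left
    proof (rule sum.cong)
      fix j assume "j \<in> {k..n - 1}"
      then have j: "k \<le> j" "j \<le> n" by auto
      show "real (j choose k) * (- s0) ^ (j - k) * pade_coeff n m \<tau> j =
         (- 1) ^ (n - k) * fact n * (real (j choose k) * real ((m + n - j) choose m) * s0 ^ (j - k) / (fact j * \<tau> ^ (n - j)))"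
        unfolding minus_power pade_coeff_eq[OF j(2) \<open>\<tau> > 0\<close>] sign[OF j, symmetric] by simp
    qed simp
    finally show "a k = (\<Sum>j=k..n. real (j choose k) * (- s0) ^ (j - k) * pade_coeff n m \<tau> j)"
      using assms(4)[of k] k by simp
  next
    fix k assume k: "k \<le> m"
    have "(\<Sum>j=k..n. real (j choose k) * (- s0) ^ (j - k) * (exp (s0 * \<tau>) * pade_delay_coeff n m \<tau> j)) =
        (\<Sum>j=k..m. real (j choose k) * (- s0) ^ (j - k) * (exp (s0 * \<tau>) * pade_delay_coeff n m \<tau> j))"
      using \<open>m \<le> n\<close> by (intro sum.mono_neutral_right) (auto simp: pade_delay_coeff_eq_0)
    also have "\<dots> = (- 1) ^ (n - 1) * exp (s0 * \<tau>) *
          (\<Sum>j = k..m. (- 1) ^ (j - k) * fact (m + n - j) * s0 ^ (j - k)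
             / (fact k * fact (j - k) * fact (m - j) * \<tau> ^ (n - j)))"
      unfolding sum_distrib_left
    proof (rule sum.cong)
      fix j assume "j \<in> {k..m}"
      then have j: "k \<le> j" "j \<le> m" by auto
      show "real (j choose k) * (- s0) ^ (j - k) * (exp (s0 * \<tau>) * pade_delay_coeff n m \<tau> j) =
         (- 1) ^ (n - 1) * exp (s0 * \<tau>) * ((- 1) ^ (j - k) * fact (m + n - j) * s0 ^ (j - k)
             / (fact k * fact (j - k) * fact (m - j) * \<tau> ^ (n - j)))"
        unfolding minus_power pade_delay_coeff_eq[OF j(2) \<open>m \<le> n\<close> \<open>n > 0\<close> \<open>\<tau> > 0\<close>] binomial_fact[OF j(1)] by (simp add: mult_ac)
    qed simp
    finally show "\<alpha> k = (\<Sum>j=k..n. real (j choose k) * (- s0) ^ (j - k) * (exp (s0 * \<tau>) * pade_delay_coeff n m \<tau> j))"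
      using assms(5)[OF k] by simp
  qed (use assms n in auto)
  have "a (n - 1) = - (real n * s0) - real n * (real m + 1) / \<tau>"
    using assms(4)[of p] by (simp add: n)
  then have "a (n - 1) > - (real n * (real m + 1) / \<tau>) \<longleftrightarrow> s0 < 0"
    using \<open>n > 0\<close> by (auto simp: mult_less_0_iff)
  then show ?thesis
    using mid_equation.stable_if_neg[OF mid] mid_equation.not_stable_if_nonneg[OF mid] by force
qed

end
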